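(* Let $(\mathcal{C},\mathcal{T})$ and $(\mathcal{C}',\mathcal{T}')$ be SHACL documents (constraints in normal form, every occurring shape name defined). Then $(\mathcal{C},\mathcal{T})$ (finitely) implies $(\mathcal{C}',\mathcal{T}')$ under the well-founded semantics iff the formula $\bigwedge_{a\in I}\langle p\rangle(a\land\Lambda_{\mathcal{C},\mathcal{T},p})\land\langle p\rangle\neg\Lambda_{\mathcal{C}',\mathcal{T}',p}$ is not (finitely) satisfiable, where $I$ is the set of individuals appearing in $(\mathcal{C},\mathcal{T})$ or $(\mathcal{C}',\mathcal{T}')$ and $p$ is a fresh role name.
   Context: Data graphs are sets (finite, or in the unrestricted version possibly countably infinite) of atoms $A(a)$, $q(a,a')$; $\Delta^{\mathcal{G}}$, $A^{\mathcal{G}}$, $q^{\mathcal{G}}$ as usual, $(q^-)^{\mathcal{G}}$ the inverse. A target is $(\ell,s)$ with $\ell$ an individual, concept name, or role and $s$ a shape name; a document is $(\mathcal{C},\mathcal{T})$ with $\mathcal{C}$ a set of shape constraints and $\mathcal{T}$ a set of targets. Normal form: constraints $s\gets A$, $s\gets a$, $s\gets\neg s'$, $s\gets\exists r.s'$, $s\gets\forall r.s'$, $s\gets s'\land s''$, $s\gets s'\lor s''$, at most one per head; $\mathcal{C}(s)$ the body. A graph is compatible with a document if it contains all individuals occurring in it; only compatible graphs are considered. Well-founded semantics: $\lfloor s\rfloor_S=\{a\mid s(a)\in S\}$, $\lceil s\rceil_S=\{a\in\Delta^{\mathcal{G}}\mid\neg s(a)\notin S\}$, $\lfloor\neg s\rfloor=\{a\mid\neg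 s(a)\in S\}$, $\lceil\neg s\rceil=\{a\in\Delta^{\mathcal{G}}\mid s(a)\notin S\}$, and for both: $[a]=\{a\}$, $[A]=A^{\mathcal{G}}$, $\lor/\land$ union/intersection, $[\forall r.\varphi]=\{a\in\Delta^{\mathcal{G}}\mid\forall a'((a,a')\in r^{\mathcal{G}}\Rightarrow a'\in[\varphi])\}$, $[\exists r.\varphi]=\{a\in\Delta^{\mathcal{G}}\mid\exists a'((a,a')\in r^{\mathcal{G}}, a'\in[\varphi])\}$. $T_{\mathcal{G},\mathcal{C}}(S)=\{s(a)\mid s\gets\varphi\in\mathcal{C},a\in\lfloor\varphi\rfloor_S\}$; $U$ unfounded w.r.t. $S,\mathcal{G},\mathcal{C}$ if $a\notin\lceil\mathcal{C}(s)\rceil_{S\cup\neg.U}$ for all $s(a)\in U$ with $\neg.U=\{\neg s(a)\mid s(a)\in U\}$; $U_{\mathcal{G},\mathcal{C}}(S)$ the greatest; $WF_{\mathcal{G},\mathcal{C}}$ the least fixed point of $W_{\mathcal{G},\mathcal{C}}(S)=T_{\mathcal{G},\mathcal{C}}(S)\cup\neg.U_{\mathcal{G},\mathcal{C}}(S)$. $\mathcal{G}$ satisfies $(\mathcal{C},\mathcal{T})$ iff $s(a)\in WF_{\mathcal{G},\mathcal{C}}$ for all $(a,s)\in\mathcal{T}$, for all $(A,s)\in\mathcal{T}$ and $a\in A^{\mathcal{G}}$, and for all $(r,s)\in\mathcal{T}$ and $(a,a')\in r^{\mathcal{G}}$. $(\mathcal{C},\mathcal{T})$ (finitely) implies $(\mathcal{C}',\mathcal{T}')$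 if every (finite) graph satisfying the first satisfies the second. Full hybrid $\mu$-calculus: $\Phi::=A\mid\neg A\mid a\mid\neg a\mid X\mid\Phi\land\Phi\mid\Phi\lor\Phi\mid[r]\Phi\mid\langle r\rangle\Phi\mid\mu X.\Phi\mid\nu X.\Phi$, standard semantics ($\|a\|=\{a\}$, modalities along $r^{\mathcal{G}}$, $\mu,\nu$ least/greatest fixed points); $\top:=A\lor\neg A$, $\bot:=A\land\neg A$; negation of a closed formula denotes complement in $\Delta^{\mathcal{G}}$; $\Phi$ is (finitely) satisfiable if $\mathcal{G},c\models\Phi$ for some (finite) graph and $c\in\Delta^{\mathcal{G}}$. Translation $tr^+_{S,\mathcal{C}},tr^-_{S,\mathcal{C}}$ (variables $X_s,X_{\bar s}$, $pos(S)$ removes barred symbols): $tr^+(s\land s')=tr^+(s)\land tr^+(s')$, $tr^-(s\land s')=tr^-(s)\lor tr^-(s')$, $tr^+(s\lor s')=tr^+(s)\lor tr^+(s')$, $tr^-(s\lor s')=tr^-(s)\land tr^-(s')$, $tr^+(\exists r.s)=\langle r\rangle tr^+(s)$, $tr^-(\exists r.s)=[r]tr^-(s)$, $tr^+(\forall r.s)=[r]tr^+(s)$, $tr^-(\forall r.s)=\langle r\rangle tr^-(s)$, $tr^+(A)=A$, $tr^-(A)=\neg A$, $tr^+(a)=a$, $tr^-(a)=\neg a$, $tr^+_{S,\mathcal{C}}(\neg s)=tr^-_{S,\mathcal{C}}(s)$, $tr^-_{S,\mathcal{C}}(\neg s)=tr^+_{pos(S),\mathcal{C}}(s)$; for a shape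 name $s$: $tr^+_{S,\mathcal{C}}(s)=X_s$ if $s\in S$ else $\mu X_s.tr^+_{S\cup\{s\},\mathcal{C}}(\mathcal{C}(s))$, and $tr^-_{S,\mathcal{C}}(s)=X_{\bar s}$ if $\bar s\in S$ else $\nu X_{\bar s}.tr^-_{S\cup\{\bar s\},\mathcal{C}}(\mathcal{C}(s))$. $\Theta_{\mathcal{C},\mathcal{T}}$ is the conjunction of $\neg a\lor tr^+_{\emptyset,\mathcal{C}}(s)$ for $(a,s)\in\mathcal{T}$, $\neg A\lor tr^+_{\emptyset,\mathcal{C}}(s)$ for $(A,s)\in\mathcal{T}$, and $\neg\langle r\rangle\top\lor tr^+_{\emptyset,\mathcal{C}}(s)$ for $(r,s)\in\mathcal{T}$. For a role name $p$, $\Lambda_{\mathcal{C},\mathcal{T},p}=\nu X.(\Theta_{\mathcal{C},\mathcal{T}}\land\bigwedge_{r\in R\cup\{p\}}[r^-]X\land\bigwedge_{r\in R\cup\{p\}}[r]X)$, where $R$ is the set of role names appearing in $(\mathcal{C},\mathcal{T})$.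
   Formalization: In the first Λ, R is taken to be the role names of both documents, not only of (C,T); and if I is empty, the conjunction ranges over one arbitrary individual instead. As printed, the equivalence fails in these cases. *)

theory Defs
  imports
    "HOL-Library.Finite_Map"
    "HOL-Library.Countable_Set"
    "HOL-Library.Infinite_Typeclass"
begin

section \<open>Data graphs\<close>

datatype ('i, 'c, 'q) gatom = CAtom 'c 'i | QAtom 'q 'i 'i

datatype 'q role = Dir 'q | Inv 'q

type_synonym ('i, 'c, 'q) graph = "('i, 'c, 'q) gatom set"

definition dom_g :: "('i, 'c, 'q) graph \<Rightarrow> 'i set" where
  "dom_g G = {a. (\<exists>A. CAtom A a \<in> G) \<or> (\<exists>q b. QAtom q a b \<in> G \<or> QAtom q b a \<in> G)}"

definition con_g :: "('i, 'c, 'q) graph \<Rightarrow> 'c \<Rightarrow> 'i set" where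
  "con_g G A = {a. CAtom A a \<in> G}"

fun role_g :: "('i, 'c, 'q) graph \<Rightarrow> 'q role \<Rightarrow> ('i \<times> 'i) set" where
  "role_g G (Dir q) = {(a, b). QAtom q a b \<in> G}"
| "role_g G (Inv q) = {(a, b). QAtom q b a \<in> G}"


section \<open>SHACL documents in normal form\<close>

text \<open>
  The set functions attached to the type parameters collect the names that occur in an
  expression; for example \<open>body_roles\<close> yields the role names \<open>q\<close>, whether used as \<open>q\<close>
  or as its inverse.
\<close>

datatype (body_inds: 'i, body_cons: 'c, body_roles: 'q, body_shapes: 's) body =
    BCon 'c
  | BInd 'i
  | BNot 's
  | BEx "'q role" 's
  | BAll "'q role" 's
  | BAnd 's 's
  | BOr 's 's

datatype (target_inds: 'i, target_cons: 'c, target_roles: 'q) target_exp =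
    TInd 'i
  | TCon 'c
  | TRole "'q role"

text \<open>
  As every shape name heads at most one constraint, a (finite) set of constraints is a finite
  partial function from shape names to bodies.
\<close>

type_synonym ('i, 'c, 'q, 's) constraints = "('s, ('i, 'c, 'q, 's) body) fmap"

type_synonym ('i, 'c, 'q, 's) document =
  "('i, 'c, 'q, 's) constraints \<times> (('i, 'c, 'q) target_exp \<times> 's) set"

fun doc_inds :: "('i, 'c, 'q, 's) document \<Rightarrow> 'i set" where
  "doc_inds (C, T) = (\<Union>\<phi>\<in>fmran' C. body_inds \<phi>) \<union> (\<Union>(l, s)\<in>T. target_inds l)"

fun doc_roles :: "('i, 'c, 'q, 's) document \<Rightarrow> 'q set" where
  "doc_roles (C, T) = (\<Union>\<phi>\<in>fmran' C. body_roles \<phi>) \<union> (\<Union>(l, s)\<in>T. target_roles l)"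

fun shacl_document :: "('i, 'c, 'q, 's) document \<Rightarrow> bool" where
  "shacl_document (C, T) \<longleftrightarrow>
     finite T \<and> (\<Union>\<phi>\<in>fmran' C. body_shapes \<phi>) \<union> snd ` T \<subseteq> fmdom' C"

definition compatible :: "('i, 'c, 'q) graph \<Rightarrow> ('i, 'c, 'q, 's) document \<Rightarrow> bool" where
  "compatible G D \<longleftrightarrow> doc_inds D \<subseteq> dom_g G"


section \<open>Well-founded semantics\<close>

datatype ('s, 'i) literal = Pos 's 'i | Neg 's 'i

fun lower :: "('i, 'c, 'q) graph \<Rightarrow> ('s, 'i) literal set \<Rightarrow> ('i, 'c, 'q, 's) body \<Rightarrow> 'i set" where
  "lower G S (BCon A) = con_g G A"
| "lower G S (BInd a) = {a}"
| "lower G S (BNot s) = {a. Neg s a \<in> S}"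
| "lower G S (BEx r s) = {a \<in> dom_g G. \<exists>b. (a, b) \<in> role_g G r \<and> b \<in> {b. Pos s b \<in> S}}"
| "lower G S (BAll r s) = {a \<in> dom_g G. \<forall>b. (a, b) \<in> role_g G r \<longrightarrow> b \<in> {b. Pos s b \<in> S}}"
| "lower G S (BAnd s t) = {a. Pos s a \<in> S} \<inter> {a. Pos t a \<in> S}"
| "lower G S (BOr s t) = {a. Pos s a \<in> S} \<union> {a. Pos t a \<in> S}"

definition upper_shape ::
  "('i, 'c, 'q) graph \<Rightarrow> ('s, 'i) literal set \<Rightarrow> 's \<Rightarrow> 'i set" where
  "upper_shape G S s = {a \<in> dom_g G. Neg s a \<notin> S}"

fun upper :: "('i, 'c, 'q) graph \<Rightarrow> ('s, 'i) literal set \<Rightarrow> ('i, 'c, 'q, 's) body \<Rightarrow> 'i set" where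
  "upper G S (BCon A) = con_g G A"
| "upper G S (BInd a) = {a}"
| "upper G S (BNot s) = {a \<in> dom_g G. Pos s a \<notin> S}"
| "upper G S (BEx r s) = {a \<in> dom_g G. \<exists>b. (a, b) \<in> role_g G r \<and> b \<in> upper_shape G S s}"
| "upper G S (BAll r s) = {a \<in> dom_g G. \<forall>b. (a, b) \<in> role_g G r \<longrightarrow> b \<in> upper_shape G S s}"
| "upper G S (BAnd s t) = upper_shape G S s \<inter> upper_shape G S t"
| "upper G S (BOr s t) = upper_shape G S s \<union> upper_shape G S t"

definition T_op :: "('i, 'c, 'q) graph \<Rightarrow> ('i, 'c, 'q, 's) constraints
    \<Rightarrow> ('s, 'i) literal set \<Rightarrow> ('s, 'i) literal set" where
  "T_op G C S = {Pos s a | s a \<phi>. fmlookup C s = Some \<phi> \<and> a \<in> lower G S \<phi>}"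

definition neg_atoms :: "('s \<times> 'i) set \<Rightarrow> ('s, 'i) literal set" where
  "neg_atoms U = {Neg s a | s a. (s, a) \<in> U}"

text \<open>A set of atoms \<open>s(a)\<close> is represented by a set of pairs \<open>(s, a)\<close>.\<close>

definition unfounded :: "('i, 'c, 'q) graph \<Rightarrow> ('i, 'c, 'q, 's) constraints
    \<Rightarrow> ('s, 'i) literal set \<Rightarrow> ('s \<times> 'i) set \<Rightarrow> bool" where
  "unfounded G C S U \<longleftrightarrow>
     (\<forall>(s, a)\<in>U. \<forall>\<phi>. fmlookup C s = Some \<phi> \<longrightarrow> a \<notin> upper G (S \<union> neg_atoms U) \<phi>)"

definition U_op :: "('i, 'c, 'q) graph \<Rightarrow> ('i, 'c, 'q, 's) constraints
    \<Rightarrow> ('s, 'i) literal set \<Rightarrow> ('s \<times> 'i) set" where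
  "U_op G C S = \<Union> {U. unfounded G C S U}"

definition W_op :: "('i, 'c, 'q) graph \<Rightarrow> ('i, 'c, 'q, 's) constraints
    \<Rightarrow> ('s, 'i) literal set \<Rightarrow> ('s, 'i) literal set" where
  "W_op G C S = T_op G C S \<union> neg_atoms (U_op G C S)"

definition WF :: "('i, 'c, 'q) graph \<Rightarrow> ('i, 'c, 'q, 's) constraints
    \<Rightarrow> ('s, 'i) literal set" where
  "WF G C = lfp (W_op G C)"

fun satisfies :: "('i, 'c, 'q) graph \<Rightarrow> ('i, 'c, 'q, 's) document \<Rightarrow> bool" where
  "satisfies G (C, T) \<longleftrightarrow>
     (\<forall>a s. (TInd a, s) \<in> T \<longrightarrow> Pos s a \<in> WF G C) \<and>
     (\<forall>A s. (TCon A, s) \<in> T \<longrightarrow> (\<forall>a\<in>con_g G A. Pos s a \<in> WF G C)) \<and>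
     (\<forall>r s. (TRole r, s) \<in> T \<longrightarrow> (\<forall>(a, b)\<in>role_g G r. Pos s a \<in> WF G C))"

text \<open>Implication ranges over the graphs compatible with both documents.\<close>

definition implies ::
  "('i, 'c, 'q, 's) document \<Rightarrow> ('i, 'c, 'q, 's) document \<Rightarrow> bool" where
  "implies D D' \<longleftrightarrow>
     (\<forall>G. countable G \<and> compatible G D \<and> compatible G D' \<and> satisfies G D \<longrightarrow> satisfies G D')"

definition fin_implies ::
  "('i, 'c, 'q, 's) document \<Rightarrow> ('i, 'c, 'q, 's) document \<Rightarrow> bool" where
  "fin_implies D D' \<longleftrightarrow>
     (\<forall>G. finite G \<and> compatible G D \<and> compatible G D' \<and> satisfies G D \<longrightarrow> satisfies G D')"

lemma lower_mono: "S \<subseteq> S' \<Longrightarrow> lower G S \<phi> \<subseteq> lower G S' \<phi>"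
  by (cases \<phi>) auto

lemma upper_antimono: "S \<subseteq> S' \<Longrightarrow> upper G S' \<phi> \<subseteq> upper G S \<phi>"
  by (cases \<phi>) (auto simp: upper_shape_def)

lemma unfounded_mono: "S \<subseteq> S' \<Longrightarrow> unfounded G C S U \<Longrightarrow> unfounded G C S' U"
  unfolding unfounded_def using upper_antimono[of "S \<union> neg_atoms U" "S' \<union> neg_atoms U"] by blast

lemma unfounded_U_op: "unfounded G C S (U_op G C S)"
proof -
  have "a \<notin> upper G (S \<union> neg_atoms (U_op G C S)) \<phi>"
    if "(s, a) \<in> U" "unfounded G C S U" "fmlookup C s = Some \<phi>" for s a U \<phi>
  proof -
    have "S \<union> neg_atoms U \<subseteq> S \<union> neg_atoms (U_op G C S)"
      using that(2) by (auto simp: neg_atoms_def U_op_def)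
    then show ?thesis
      using that upper_antimono unfolding unfounded_def by blast
  qed
  then show ?thesis
    by (subst unfounded_def) (auto simp: U_op_def)
qed

lemma mono_W_op: "mono (W_op G C)"
proof (rule monoI)
  fix S S' :: "('a, 'b) literal set"
  assume le: "S \<subseteq> S'"
  have "T_op G C S \<subseteq> T_op G C S'"
    unfolding T_op_def using lower_mono[OF le] by blast
  moreover have "U_op G C S \<subseteq> U_op G C S'"
    unfolding U_op_def using unfounded_mono[OF le] by blast
  ultimately show "W_op G C S \<subseteq> W_op G C S'"
    unfolding W_op_def neg_atoms_def by blast
qed


section \<open>The full hybrid mu-calculus\<close>

datatype ('i, 'c, 'q, 'v) fm =
    Con 'c
  | NCon 'c
  | Nom 'i
  | NNom 'i
  | Var 'v
  | And "('i, 'c, 'q, 'v) fm" "('i, 'c, 'q, 'v) fm"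
  | Or "('i, 'c, 'q, 'v) fm" "('i, 'c, 'q, 'v) fm"
  | Box "'q role" "('i, 'c, 'q, 'v) fm"
  | Dia "'q role" "('i, 'c, 'q, 'v) fm"
  | Mu 'v "('i, 'c, 'q, 'v) fm"
  | Nu 'v "('i, 'c, 'q, 'v) fm"

text \<open>
  The intersection with the domain in the clause for nominals only matters for individuals
  outside the graph; it makes every formula denote a subset of the domain.
\<close>

fun sem :: "('i, 'c, 'q) graph \<Rightarrow> ('v \<Rightarrow> 'i set) \<Rightarrow> ('i, 'c, 'q, 'v) fm \<Rightarrow> 'i set" where
  "sem G V (Con A) = con_g G A"
| "sem G V (NCon A) = dom_g G - con_g G A"
| "sem G V (Nom a) = {a} \<inter> dom_g G"
| "sem G V (NNom a) = dom_g G - {a}"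
| "sem G V (Var X) = V X"
| "sem G V (And \<phi> \<psi>) = sem G V \<phi> \<inter> sem G V \<psi>"
| "sem G V (Or \<phi> \<psi>) = sem G V \<phi> \<union> sem G V \<psi>"
| "sem G V (Box r \<phi>) = {a \<in> dom_g G. \<forall>b. (a, b) \<in> role_g G r \<longrightarrow> b \<in> sem G V \<phi>}"
| "sem G V (Dia r \<phi>) = {a \<in> dom_g G. \<exists>b. (a, b) \<in> role_g G r \<and> b \<in> sem G V \<phi>}"
| "sem G V (Mu X \<phi>) = \<Inter> {E. E \<subseteq> dom_g G \<and> sem G (V(X := E)) \<phi> \<subseteq> E}"
| "sem G V (Nu X \<phi>) = \<Union> {E. E \<subseteq> dom_g G \<and> E \<subseteq> sem G (V(X := E)) \<phi>}"

text \<open>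
  Negation normal form of the negation. Variables are left unchanged: negating the body of a
  fixed point and replacing its variable by the negated variable cancel out.
\<close>

fun neg :: "('i, 'c, 'q, 'v) fm \<Rightarrow> ('i, 'c, 'q, 'v) fm" where
  "neg (Con A) = NCon A"
| "neg (NCon A) = Con A"
| "neg (Nom a) = NNom a"
| "neg (NNom a) = Nom a"
| "neg (Var X) = Var X"
| "neg (And \<phi> \<psi>) = Or (neg \<phi>) (neg \<psi>)"
| "neg (Or \<phi> \<psi>) = And (neg \<phi>) (neg \<psi>)"
| "neg (Box r \<phi>) = Dia r (neg \<phi>)"
| "neg (Dia r \<phi>) = Box r (neg \<phi>)"
| "neg (Mu X \<phi>) = Nu X (neg \<phi>)"
| "neg (Nu X \<phi>) = Mu X (neg \<phi>)"

fun free_vars :: "('i, 'c, 'q, 'v) fm \<Rightarrow> 'v set" where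
  "free_vars (Var X) = {X}"
| "free_vars (And \<phi> \<psi>) = free_vars \<phi> \<union> free_vars \<psi>"
| "free_vars (Or \<phi> \<psi>) = free_vars \<phi> \<union> free_vars \<psi>"
| "free_vars (Box r \<phi>) = free_vars \<phi>"
| "free_vars (Dia r \<phi>) = free_vars \<phi>"
| "free_vars (Mu X \<phi>) = free_vars \<phi> - {X}"
| "free_vars (Nu X \<phi>) = free_vars \<phi> - {X}"
| "free_vars _ = {}"

text \<open>Only used for closed formulas, so the choice of the valuation is immaterial.\<close>

definition holds :: "('i, 'c, 'q) graph \<Rightarrow> 'i \<Rightarrow> ('i, 'c, 'q, 'v) fm \<Rightarrow> bool" where
  "holds G c \<phi> \<longleftrightarrow> c \<in> sem G (\<lambda>_. {}) \<phi>"

definition satisfiable :: "('i, 'c, 'q, 'v) fm \<Rightarrow> bool" where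
  "satisfiable \<phi> \<longleftrightarrow>
     (\<exists>(G :: ('i, 'c, 'q) graph) c. countable G \<and> c \<in> dom_g G \<and> holds G c \<phi>)"

definition fin_satisfiable :: "('i, 'c, 'q, 'v) fm \<Rightarrow> bool" where
  "fin_satisfiable \<phi> \<longleftrightarrow>
     (\<exists>(G :: ('i, 'c, 'q) graph) c. finite G \<and> c \<in> dom_g G \<and> holds G c \<phi>)"

text \<open>The concept name used in \<open>\<top> = A \<or> \<not> A\<close> is irrelevant.\<close>

definition Top :: "('i, 'c, 'q, 'v) fm" where
  "Top = Or (Con undefined) (NCon undefined)"

definition Bot :: "('i, 'c, 'q, 'v) fm" where
  "Bot = And (Con undefined) (NCon undefined)"

text \<open>
  Conjunction of the formulas \<open>f x\<close> for \<open>x\<close> in a finite set; the order in which the set is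
  enumerated is irrelevant.
\<close>

definition Conj :: "'a set \<Rightarrow> ('a \<Rightarrow> ('i, 'c, 'q, 'v) fm) \<Rightarrow> ('i, 'c, 'q, 'v) fm" where
  "Conj M f = foldr (\<lambda>x. And (f x)) (SOME xs. set xs = M \<and> distinct xs) Top"

lemma con_g_subset: "con_g G A \<subseteq> dom_g G"
  by (auto simp: con_g_def dom_g_def)

lemma role_g_subset: "(a, b) \<in> role_g G r \<Longrightarrow> a \<in> dom_g G \<and> b \<in> dom_g G"
  by (cases r) (auto simp: dom_g_def)

lemma sem_Top: "sem G V Top = dom_g G"
  using con_g_subset[of G undefined] by (auto simp: Top_def)

lemma sem_Conj:
  assumes "finite M"
  shows "sem G V (Conj M f) = {a \<in> dom_g G. \<forall>x\<in>M. a \<in> sem G V (f x)}"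
proof -
  have fold: "sem G V (foldr (\<lambda>x. And (f x)) xs Top) = {a \<in> dom_g G. \<forall>x\<in>set xs. a \<in> sem G V (f x)}"
    for xs
    by (induction xs) (auto simp: sem_Top)
  have "set (SOME xs. set xs = M \<and> distinct xs) = M"
    using someI_ex[OF finite_distinct_list[OF assms]] by simp
  then show ?thesis
    unfolding Conj_def fold by simp
qed

lemma sem_subset: "(\<And>X. V X \<subseteq> dom_g G) \<Longrightarrow> sem G V \<phi> \<subseteq> dom_g G"
proof (induction \<phi> arbitrary: V)
  case (Con A) then show ?case by (simp add: con_g_subset)
next
  case (And \<phi> \<psi>) then show ?case by (simp add: le_infI1)
next
  case (Mu X \<phi>)
  have "sem G (V(X := dom_g G)) \<phi> \<subseteq> dom_g G"
    by (rule Mu.IH) (use Mu.prems in auto)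
  then show ?case by auto
qed auto

lemma sem_neg:
  assumes "\<And>X. V X \<subseteq> dom_g G"
  shows "sem G (\<lambda>X. dom_g G - V X) (neg \<phi>) = dom_g G - sem G V \<phi>"
  using assms
proof (induction \<phi> arbitrary: V)
  case (NCon A) then show ?case using con_g_subset[of G A] by auto
next
  case (Mu X \<phi>)
  have eq: "sem G ((\<lambda>Y. dom_g G - V Y)(X := dom_g G - E)) (neg \<phi>) =
      dom_g G - sem G (V(X := E)) \<phi>" if "E \<subseteq> dom_g G" for E
  proof -
    have *: "(\<lambda>Y. dom_g G - V Y)(X := dom_g G - E) = (\<lambda>Y. dom_g G - (V(X := E)) Y)"
      by (simp add: fun_eq_iff)
    have "(V(X := E)) Y \<subseteq> dom_g G" for Y
      using Mu.prems that by simp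
    then show ?thesis
      unfolding * by (rule Mu.IH)
  qed
  have "a \<in> sem G (\<lambda>Y. dom_g G - V Y) (Nu X (neg \<phi>)) \<longleftrightarrow>
      a \<in> dom_g G - sem G V (Mu X \<phi>)" for a
  proof
    assume "a \<in> sem G (\<lambda>Y. dom_g G - V Y) (Nu X (neg \<phi>))"
    then obtain E where E: "a \<in> E" "E \<subseteq> dom_g G"
      "E \<subseteq> sem G ((\<lambda>Y. dom_g G - V Y)(X := E)) (neg \<phi>)" by auto
    let ?F = "dom_g G - E"
    have EF: "dom_g G - ?F = E" using E(2) by auto
    have "sem G ((\<lambda>Y. dom_g G - V Y)(X := E)) (neg \<phi>) = dom_g G - sem G (V(X := ?F)) \<phi>"
      using eq[of ?F] EF by auto
    then have "E \<inter> sem G (V(X := ?F)) \<phi> = {}" using E(3) by auto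
    moreover have "sem G (V(X := ?F)) \<phi> \<subseteq> dom_g G"
      by (rule sem_subset) (use Mu.prems in auto)
    ultimately have "sem G (V(X := ?F)) \<phi> \<subseteq> ?F" by auto
    then have "a \<notin> sem G V (Mu X \<phi>)" using E(1) by auto
    then show "a \<in> dom_g G - sem G V (Mu X \<phi>)" using E by auto
  next
    assume a: "a \<in> dom_g G - sem G V (Mu X \<phi>)"
    then obtain F where F: "F \<subseteq> dom_g G" "sem G (V(X := F)) \<phi> \<subseteq> F" "a \<notin> F" by auto
    have "dom_g G - F \<subseteq> sem G ((\<lambda>Y. dom_g G - V Y)(X := dom_g G - F)) (neg \<phi>)"
      using eq[OF F(1)] F(2) by auto
    then show "a \<in> sem G (\<lambda>Y. dom_g G - V Y) (Nu X (neg \<phi>))" using a F(3) by auto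
  qed
  then show ?case unfolding neg.simps by (rule set_eqI)
next
  case (Nu X \<phi>)
  have eq: "sem G ((\<lambda>Y. dom_g G - V Y)(X := dom_g G - E)) (neg \<phi>) =
      dom_g G - sem G (V(X := E)) \<phi>" if "E \<subseteq> dom_g G" for E
  proof -
    have *: "(\<lambda>Y. dom_g G - V Y)(X := dom_g G - E) = (\<lambda>Y. dom_g G - (V(X := E)) Y)"
      by (simp add: fun_eq_iff)
    have "(V(X := E)) Y \<subseteq> dom_g G" for Y
      using Nu.prems that by simp
    then show ?thesis
      unfolding * by (rule Nu.IH)
  qed
  have Mu_sub: "sem G (\<lambda>Y. dom_g G - V Y) (Mu X (neg \<phi>)) \<subseteq> dom_g G"
    by (rule sem_subset) auto
  have "a \<in> sem G (\<lambda>Y. dom_g G - V Y) (Mu X (neg \<phi>)) \<longleftrightarrow>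
      a \<in> dom_g G - sem G V (Nu X \<phi>)" for a
  proof
    assume a: "a \<in> sem G (\<lambda>Y. dom_g G - V Y) (Mu X (neg \<phi>))"
    have "a \<notin> E" if E: "E \<subseteq> dom_g G" "E \<subseteq> sem G (V(X := E)) \<phi>" for E
    proof -
      have "sem G ((\<lambda>Y. dom_g G - V Y)(X := dom_g G - E)) (neg \<phi>) \<subseteq> dom_g G - E"
        using eq[OF E(1)] E(2) by auto
      then show ?thesis using a by auto
    qed
    moreover have "a \<in> dom_g G" using a Mu_sub by blast
    ultimately show "a \<in> dom_g G - sem G V (Nu X \<phi>)" unfolding sem.simps by blast
  next
    assume a: "a \<in> dom_g G - sem G V (Nu X \<phi>)"
    have "a \<in> F" if F: "F \<subseteq> dom_g G" "sem G ((\<lambda>Y. dom_g G - V Y)(X := F)) (neg \<phi>) \<subseteq> F" for F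
    proof (rule ccontr)
      assume "a \<notin> F"
      let ?E = "dom_g G - F"
      have EF: "dom_g G - ?E = F" using F(1) by auto
      have "dom_g G - sem G (V(X := ?E)) \<phi> \<subseteq> F" using eq[of ?E] EF F(2) by auto
      then have "?E \<subseteq> sem G (V(X := ?E)) \<phi>" by auto
      then show False using a \<open>a \<notin> F\<close> by auto
    qed
    then show "a \<in> sem G (\<lambda>Y. dom_g G - V Y) (Mu X (neg \<phi>))" by auto
  qed
  then show ?case unfolding neg.simps by (rule set_eqI)
next
  case (Box r \<phi>) then show ?case using role_g_subset[of _ _ G r] by auto
next
  case (Dia r \<phi>) then show ?case using role_g_subset[of _ _ G r] by auto
qed auto

lemma sem_cong: "(\<And>X. X \<in> free_vars \<phi> \<Longrightarrow> V X = V' X) \<Longrightarrow> sem G V \<phi> = sem G V' \<phi>"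
proof (induction \<phi> arbitrary: V V')
  case (And \<phi> \<psi>)
  have "sem G V \<phi> = sem G V' \<phi>" "sem G V \<psi> = sem G V' \<psi>"
    by (rule And.IH; use And.prems in simp)+
  then show ?case by simp
next
  case (Or \<phi> \<psi>)
  have "sem G V \<phi> = sem G V' \<phi>" "sem G V \<psi> = sem G V' \<psi>"
    by (rule Or.IH; use Or.prems in simp)+
  then show ?case by simp
next
  case (Box r \<phi>)
  have "sem G V \<phi> = sem G V' \<phi>"
    by (rule Box.IH; use Box.prems in simp)
  then show ?case by simp
next
  case (Dia r \<phi>)
  have "sem G V \<phi> = sem G V' \<phi>"
    by (rule Dia.IH; use Dia.prems in simp)
  then show ?case by simp
next
  case (Mu X \<phi>)
  have "sem G (V(X := E)) \<phi> = sem G (V'(X := E)) \<phi>" for E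
    by (rule Mu.IH) (use Mu.prems in auto)
  then show ?case by simp
next
  case (Nu X \<phi>)
  have "sem G (V(X := E)) \<phi> = sem G (V'(X := E)) \<phi>" for E
    by (rule Nu.IH) (use Nu.prems in auto)
  then show ?case by simp
qed auto

lemma free_vars_neg [simp]: "free_vars (neg \<phi>) = free_vars \<phi>"
  by (induction \<phi>) auto

lemma holds_neg:
  assumes "free_vars \<phi> = {}" "c \<in> dom_g G"
  shows "holds G c (neg \<phi>) \<longleftrightarrow> \<not> holds G c \<phi>"
proof -
  have "sem G (\<lambda>_. {}) (neg \<phi>) = sem G (\<lambda>_. dom_g G - {}) (neg \<phi>)"
    by (rule sem_cong) (simp add: assms(1))
  also have "\<dots> = dom_g G - sem G (\<lambda>_. {}) \<phi>"
    by (rule sem_neg) simp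
  finally show ?thesis
    unfolding holds_def using assms(2) by blast
qed


section \<open>Translation\<close>

text \<open>
  \<open>VPos s\<close> and \<open>VNeg s\<close> are the variables for \<open>s\<close> and for the barred symbol of \<open>s\<close>; they also
  serve as the elements of the set parameter of the translation. \<open>VReach\<close> is the variable
  bound at the top of \<open>Lambda\<close>.
\<close>

datatype 's fvar = VPos 's | VNeg 's | VReach

definition pos :: "'s fvar set \<Rightarrow> 's fvar set" where
  "pos S = S - range VNeg"

text \<open>
  The positive and the negative translation, each for shape names and for bodies. The
  \<open>None\<close> cases are unreachable in documents, where every occurring shape name is defined.
\<close>

function trp :: "('i, 'c, 'q, 's) constraints \<Rightarrow> 's fvar set \<Rightarrow> 's
      \<Rightarrow> ('i, 'c, 'q, 's fvar) fm"
  and trp_body :: "('i, 'c, 'q, 's) constraints \<Rightarrow> 's fvar set \<Rightarrow> ('i, 'c, 'q, 's) body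
      \<Rightarrow> ('i, 'c, 'q, 's fvar) fm"
  and trn :: "('i, 'c, 'q, 's) constraints \<Rightarrow> 's fvar set \<Rightarrow> 's
      \<Rightarrow> ('i, 'c, 'q, 's fvar) fm"
  and trn_body :: "('i, 'c, 'q, 's) constraints \<Rightarrow> 's fvar set \<Rightarrow> ('i, 'c, 'q, 's) body
      \<Rightarrow> ('i, 'c, 'q, 's fvar) fm"
where
  "trp C S s =
     (if VPos s \<in> S then Var (VPos s)
      else case fmlookup C s of
        Some \<phi> \<Rightarrow> Mu (VPos s) (trp_body C (S \<union> {VPos s}) \<phi>)
      | None \<Rightarrow> Bot)"
| "trp_body C S (BCon A) = Con A"
| "trp_body C S (BInd a) = Nom a"
| "trp_body C S (BNot s) = trn C S s"
| "trp_body C S (BEx r s) = Dia r (trp C S s)"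
| "trp_body C S (BAll r s) = Box r (trp C S s)"
| "trp_body C S (BAnd s t) = And (trp C S s) (trp C S t)"
| "trp_body C S (BOr s t) = Or (trp C S s) (trp C S t)"
| "trn C S s =
     (if VNeg s \<in> S then Var (VNeg s)
      else case fmlookup C s of
        Some \<phi> \<Rightarrow> Nu (VNeg s) (trn_body C (S \<union> {VNeg s}) \<phi>)
      | None \<Rightarrow> Top)"
| "trn_body C S (BCon A) = NCon A"
| "trn_body C S (BInd a) = NNom a"
| "trn_body C S (BNot s) = trp C (pos S) s"
| "trn_body C S (BEx r s) = Box r (trn C S s)"
| "trn_body C S (BAll r s) = Dia r (trn C S s)"
| "trn_body C S (BAnd s t) = Or (trn C S s) (trn C S t)"
| "trn_body C S (BOr s t) = And (trn C S s) (trn C S t)"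
  by pat_completeness auto

definition missing_pos :: "('i, 'c, 'q, 's) constraints \<Rightarrow> 's fvar set \<Rightarrow> nat" where
  "missing_pos C S = card {s \<in> fmdom' C. VPos s \<notin> S}"

definition missing_neg :: "('i, 'c, 'q, 's) constraints \<Rightarrow> 's fvar set \<Rightarrow> nat" where
  "missing_neg C S = card {s \<in> fmdom' C. VNeg s \<notin> S}"

lemma missing_pos_insert:
  "VPos s \<notin> S \<Longrightarrow> fmlookup C s = Some \<phi> \<Longrightarrow>
   missing_pos C (insert (VPos s) S) < missing_pos C S"
  unfolding missing_pos_def
  by (rule psubset_card_mono[OF finite_subset[OF _ finite_fmdom']]) (auto intro: fmdom'I)

lemma missing_neg_insert:
  "VNeg s \<notin> S \<Longrightarrow> fmlookup C s = Some \<phi> \<Longrightarrow>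
   missing_neg C (insert (VNeg s) S) < missing_neg C S"
  unfolding missing_neg_def
  by (rule psubset_card_mono[OF finite_subset[OF _ finite_fmdom']]) (auto intro: fmdom'I)

lemma missing_pos_simps [simp]:
  "missing_pos C (insert (VNeg s) S) = missing_pos C S"
  "missing_pos C (pos S) = missing_pos C S"
  by (auto simp: missing_pos_def pos_def intro!: arg_cong[where f = card])

termination
  by (relation "inv_image (less_than <*lex*> less_than <*lex*> less_than <*lex*> less_than)
      (\<lambda>x. case x of
         Inl (Inl (C, S, s)) \<Rightarrow> (missing_pos C S, 0, 0, 0)
       | Inl (Inr (C, S, \<phi>)) \<Rightarrow> (missing_pos C S, 2, 0, 0)
       | Inr (Inl (C, S, s)) \<Rightarrow> (missing_pos C S, 1, missing_neg C S, 0)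
       | Inr (Inr (C, S, \<phi>)) \<Rightarrow> (missing_pos C S, 1, missing_neg C S, 1 :: nat))")
    (auto simp: missing_pos_insert missing_neg_insert)

fun Theta :: "('i, 'c, 'q, 's) document \<Rightarrow> ('i, 'c, 'q, 's fvar) fm" where
  "Theta (C, T) = Conj T (\<lambda>(l, s). Or
     (case l of
        TInd a \<Rightarrow> NNom a
      | TCon A \<Rightarrow> NCon A
      | TRole r \<Rightarrow> neg (Dia r Top))
     (trp C {} s))"

text \<open>
  The set \<open>R\<close> of role names is a parameter, since a reduction that involves two documents
  has to close under the role names of both.
\<close>

definition Lambda :: "'q set \<Rightarrow> ('i, 'c, 'q, 's) document \<Rightarrow> 'q \<Rightarrow> ('i, 'c, 'q, 's fvar) fm" where
  "Lambda R D p = Nu VReach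
     (And (Theta D)
       (And (Conj (R \<union> {p}) (\<lambda>r. Box (Inv r) (Var VReach)))
            (Conj (R \<union> {p}) (\<lambda>r. Box (Dir r) (Var VReach)))))"

end

theory Submission
  imports Defs
begin

text \<open>
  The translation of a shape name unfolds the constraints along a branch and closes a loop with
  the fixed point variable opened there. Its greatest fixed points are handled by coinduction
  with accumulated hypotheses: a set that is unfounded when it may itself be assumed unfounded is
  unfounded. Least fixed points are handled dually, by letting the iteration to the well-founded
  model use only atoms from a given set. Hence on the domain the translation defines exactly the
  positive literals of the well-founded model.

  A counterexample to the implication becomes a model of the formula by adding \<open>p\<close>-edges from a
  violating node \<open>v\<close> to itself and to the individuals in \<open>I\<close>: the node \<open>v\<close> also serves as the
  root, so no fresh individual is needed, and \<open>p\<close>-edges are invisible to both documents.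
  Conversely, \<open>Lambda\<close> holds at a node iff every node of its connected component meets the
  targets, so the connected component of the root is a counterexample. As \<open>I\<close> is
  nonempty, this component is also that of a node satisfying \<open>Lambda\<close> for the first document.
\<close>

section \<open>Translation and well-founded semantics\<close>

declare trp.simps [simp del] trn.simps [simp del]

section \<open>Unfounded sets under hypotheses; soundness of the translation\<close>

lemma WF_unfold: "WF G C = W_op G C (WF G C)"
  unfolding WF_def by (rule lfp_unfold[OF mono_W_op])

lemma neg_atoms_iff [simp]: "Pos s a \<notin> neg_atoms U" "Neg s a \<in> neg_atoms U \<longleftrightarrow> (s, a) \<in> U"
  by (auto simp: neg_atoms_def)

text \<open>For \<open>H = {}\<close> the post-fixed points are the unfounded sets inside the
  domain. Atoms in \<open>H\<close> count as false when a body is tested, but receive no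
  justification themselves.\<close>

definition unf_step :: "('i, 'c, 'q) graph \<Rightarrow> ('i, 'c, 'q, 's) constraints
    \<Rightarrow> ('s, 'i) literal set \<Rightarrow> ('s \<times> 'i) set \<Rightarrow> ('s \<times> 'i) set \<Rightarrow> ('s \<times> 'i) set" where
  "unf_step G C W H U =
     {(s, a). a \<in> dom_g G \<and>
        (\<forall>\<phi>. fmlookup C s = Some \<phi> \<longrightarrow> a \<notin> upper G (W \<union> neg_atoms (U \<union> H)) \<phi>)}"

definition unf_from :: "('i, 'c, 'q) graph \<Rightarrow> ('i, 'c, 'q, 's) constraints
    \<Rightarrow> ('s, 'i) literal set \<Rightarrow> ('s \<times> 'i) set \<Rightarrow> ('s \<times> 'i) set" where
  "unf_from G C W H = gfp (unf_step G C W H)"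

lemma mono_unf_step: "mono (unf_step G C W H)"
proof (rule monoI)
  fix U U' :: "('a \<times> 'b) set"
  assume "U \<subseteq> U'"
  then have "W \<union> neg_atoms (U \<union> H) \<subseteq> W \<union> neg_atoms (U' \<union> H)"
    by (auto simp: neg_atoms_def)
  then show "unf_step G C W H U \<subseteq> unf_step G C W H U'"
    unfolding unf_step_def using upper_antimono by blast
qed

lemma unf_from_unfold: "unf_from G C W H = unf_step G C W H (unf_from G C W H)"
  unfolding unf_from_def by (rule gfp_unfold[OF mono_unf_step])

text \<open>This is the accumulation rule of parameterised coinduction: \<open>?X\<close> already
  contains \<open>E\<close>, so counting \<open>E\<close> as a hypothesis adds nothing, and
  \<open>?X\<close> is a post-fixed point for \<open>H\<close> alone.\<close>

lemma unf_from_accumulate: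
  assumes "E \<subseteq> unf_from G C W (H \<union> E)"
  shows "E \<subseteq> unf_from G C W H"
proof -
  let ?X = "unf_from G C W (H \<union> E)"
  have "?X \<union> (H \<union> E) = ?X \<union> H"
    using assms by auto
  then have "?X \<subseteq> unf_step G C W H ?X"
    using unf_from_unfold[of G C W "H \<union> E"] unfolding unf_step_def by simp
  then have "?X \<subseteq> unf_from G C W H"
    unfolding unf_from_def by (rule gfp_upperbound)
  then show ?thesis
    using assms by blast
qed

lemma unf_from_WF: "(s, a) \<in> unf_from G C (WF G C) {} \<Longrightarrow> Neg s a \<in> WF G C"
proof -
  let ?U = "unf_from G C (WF G C) {}"
  assume a: "(s, a) \<in> ?U"
  have "unfounded G C (WF G C) ?U"
    using unf_from_unfold[of G C "WF G C" "{}"] unfolding unfounded_def unf_step_def by auto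
  then have "?U \<subseteq> U_op G C (WF G C)"
    by (auto simp: U_op_def)
  then have "Neg s a \<in> W_op G C (WF G C)"
    using a by (auto simp: W_op_def)
  then show ?thesis
    using WF_unfold by blast
qed

text \<open>
  The set \<open>H\<close> collects the coinductive hypotheses made by the enclosing greatest fixed points.
\<close>

lemma tr_sound:
  fixes G :: "('i, 'c, 'q) graph" and C :: "('i, 'c, 'q, 's) constraints"
  defines "PB \<equiv> \<lambda>S V C. (\<forall>X. V X \<subseteq> dom_g G) \<and>
      (\<forall>t. VPos t \<in> S \<longrightarrow> V (VPos t) \<subseteq> {a. Pos t a \<in> WF G C})"
    and "NB \<equiv> \<lambda>S V H. \<forall>t. VNeg t \<in> S \<longrightarrow> V (VNeg t) \<subseteq> {a. (t, a) \<in> H}"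
  shows "S \<inter> range VNeg = {} \<Longrightarrow> PB S V C \<Longrightarrow> sem G V (trp C S s) \<subseteq> {a. Pos s a \<in> WF G C}"
    and "S \<inter> range VNeg = {} \<Longrightarrow> PB S V C \<Longrightarrow> sem G V (trp_body C S \<phi>) \<subseteq> lower G (WF G C) \<phi>"
    and "PB S V C \<Longrightarrow> NB S V H \<Longrightarrow>
      sem G V (trn C S s) \<subseteq> {a. (s, a) \<in> unf_from G C (WF G C) H \<union> H}"
    and "PB S V C \<Longrightarrow> NB S V H \<Longrightarrow> sem G V (trn_body C S \<phi>) \<subseteq>
      dom_g G - upper G (WF G C \<union> neg_atoms (unf_from G C (WF G C) H \<union> H)) \<phi>"
proof (induction C S s and C S \<phi> and C S s and C S \<phi> arbitrary: V and V and V H and V H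
    rule: trp_trp_body_trn_trn_body.induct)
  case (1 C S s)
  show ?case
  proof (cases "VPos s \<in> S")
    case True
    with 1 show ?thesis by (auto simp: trp.simps PB_def)
  next
    case nin: False
    show ?thesis
    proof (cases "fmlookup C s")
      case None
      with nin show ?thesis by (auto simp: trp.simps Bot_def)
    next
      case (Some \<phi>)
      \<comment> \<open>The true atoms of \<open>s\<close> will form a pre-fixed point of the
        \<open>Mu\<close> body, so the least fixed point lies below them.\<close>
      let ?E = "{a \<in> dom_g G. Pos s a \<in> WF G C}"
      have PB': "PB (S \<union> {VPos s}) (V(VPos s := ?E)) C"
        using "1.prems"(2) unfolding PB_def by auto
      have "sem G (V(VPos s := ?E)) (trp_body C (S \<union> {VPos s}) \<phi>) \<subseteq> lower G (WF G C) \<phi>"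
        by (rule "1.IH"[OF nin Some _ PB']) (use "1.prems"(1) in auto)
      also have "\<dots> \<subseteq> {a. Pos s a \<in> WF G C}"
        using Some WF_unfold[of G C] by (auto simp: W_op_def T_op_def)
      finally have "sem G (V(VPos s := ?E)) (trp_body C (S \<union> {VPos s}) \<phi>) \<subseteq> ?E"
        using sem_subset[of "V(VPos s := ?E)" G] PB' unfolding PB_def by blast
      then have "sem G V (trp C S s) \<subseteq> ?E"
        using nin Some unfolding trp.simps[of C S s] by (simp add: Inter_lower)
      then show ?thesis by blast
    qed
  qed
next
  case (4 C S s)
  \<comment> \<open>No barred variable is open here, so the coinduction behind the negation starts
    without hypotheses, and \<open>unf_from_WF\<close> applies to its result.\<close>
  have "NB S V {}"
    using 4 by (auto simp: NB_def)
  from "4.IH"[OF "4.prems"(2) this] show ?case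
    using unf_from_WF[of s _ G C] by auto
next
  case (9 C S s)
  show ?case
  proof (cases "VNeg s \<in> S")
    case True
    with 9 show ?thesis by (auto simp: trn.simps NB_def)
  next
    case nin: False
    show ?thesis
    proof (cases "fmlookup C s")
      case None
      then have "a \<in> dom_g G \<Longrightarrow> (s, a) \<in> unf_from G C (WF G C) H" for a
        by (subst unf_from_unfold) (simp add: unf_step_def)
      with nin None show ?thesis by (auto simp: trn.simps sem_Top)
    next
      case (Some \<phi>)
      \<comment> \<open>\<open>E\<close> is an arbitrary post-fixed point of the \<open>Nu\<close>
        body; its atoms become hypotheses for the body and are discharged by accumulation.\<close>
      have "{s} \<times> E \<subseteq> unf_from G C (WF G C) H"
        if E: "E \<subseteq> dom_g G" "E \<subseteq> sem G (V(VNeg s := E)) (trn_body C (S \<union> {VNeg s}) \<phi>)" for E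
      proof (rule unf_from_accumulate)
        let ?H = "H \<union> {s} \<times> E"
        have "PB (S \<union> {VNeg s}) (V(VNeg s := E)) C" "NB (S \<union> {VNeg s}) (V(VNeg s := E)) ?H"
          using "9.prems" E(1) by (auto simp: PB_def NB_def)
        from "9.IH"[OF nin Some this] E(2)
        have "E \<subseteq> dom_g G - upper G (WF G C \<union> neg_atoms (unf_from G C (WF G C) ?H \<union> ?H)) \<phi>"
          by (rule subset_trans[rotated])
        then show "{s} \<times> E \<subseteq> unf_from G C (WF G C) ?H"
          by (subst unf_from_unfold) (use Some in \<open>auto simp: unf_step_def\<close>)
      qed
      with nin Some show ?thesis by (auto simp: trn.simps)
    qed
  qed
next
  case (12 C S s)
  \<comment> \<open>Hypotheses do not pass through a negation: \<open>BNot s\<close> fails only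
    where the positive literal is in the model itself, and \<open>neg_atoms\<close> supplies none.
    Hence \<open>pos\<close> discards the barred variables.\<close>
  have "PB (pos S) V C" "pos S \<inter> range VNeg = {}"
    using "12.prems" by (auto simp: PB_def pos_def)
  with "12.IH" have "sem G V (trp C (pos S) s) \<subseteq> {a. Pos s a \<in> WF G C}" by blast
  moreover have "sem G V (trp C (pos S) s) \<subseteq> dom_g G"
    by (rule sem_subset) (use "12.prems" in \<open>auto simp: PB_def\<close>)
  ultimately show ?case by auto
next
  case (2 C S A) show ?case by simp
next
  case (3 C S a) show ?case by auto
next
  case (5 C S r s)
  from "5.IH"[OF "5.prems"] show ?case by auto
next
  case (6 C S r s)
  from "6.IH"[OF "6.prems"] show ?case by auto
next
  case (7 C S s t)
  from "7.IH"(1)[OF "7.prems"] "7.IH"(2)[OF "7.prems"] show ?case by auto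
next
  case (8 C S s t)
  from "8.IH"(1)[OF "8.prems"] "8.IH"(2)[OF "8.prems"] show ?case by auto
next
  case (10 C S A) show ?case by auto
next
  case (11 C S a) show ?case by auto
next
  case (13 C S r s)
  from "13.IH"[OF "13.prems"] show ?case by (auto simp: upper_shape_def)
next
  case (14 C S r s)
  from "14.IH"[OF "14.prems"] show ?case by (auto simp: upper_shape_def)
next
  case (15 C S s t)
  have "sem G V (trn C S s) \<subseteq> dom_g G" "sem G V (trn C S t) \<subseteq> dom_g G"
    by (rule sem_subset; use "15.prems" in \<open>simp add: PB_def\<close>)+
  with "15.IH"(1)[OF "15.prems"] "15.IH"(2)[OF "15.prems"] show ?case
    by (auto simp: upper_shape_def)
next
  case (16 C S s t)
  have "sem G V (trn C S s) \<subseteq> dom_g G" "sem G V (trn C S t) \<subseteq> dom_g G"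
    by (rule sem_subset; use "16.prems" in \<open>simp add: PB_def\<close>)+
  with "16.IH"(1)[OF "16.prems"] "16.IH"(2)[OF "16.prems"] show ?case
    by (auto simp: upper_shape_def)
qed

section \<open>Cut-down iterations and completeness of the translation\<close>

text \<open>
  Dually to \<open>unf_from\<close>, the atoms available to an iteration step are cut down to a set \<open>K\<close>
  of inductive hypotheses made by the enclosing least fixed points.
\<close>

definition lits_on :: "('s \<times> 'i) set \<Rightarrow> ('s, 'i) literal set" where
  "lits_on K = {Pos s a | s a. (s, a) \<in> K} \<union> range (\<lambda>(s, a). Neg s a)"

lemma lits_on_iff [simp]: "Pos s a \<in> lits_on K \<longleftrightarrow> (s, a) \<in> K" "Neg s a \<in> lits_on K"
  by (auto simp: lits_on_def)

definition WF_on :: "('i, 'c, 'q) graph \<Rightarrow> ('i, 'c, 'q, 's) constraints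
    \<Rightarrow> ('s \<times> 'i) set \<Rightarrow> ('s, 'i) literal set" where
  "WF_on G C K = lfp (\<lambda>S. W_op G C (S \<inter> lits_on K))"

definition WF_cut :: "('i, 'c, 'q) graph \<Rightarrow> ('i, 'c, 'q, 's) constraints
    \<Rightarrow> ('s \<times> 'i) set \<Rightarrow> ('s, 'i) literal set" where
  "WF_cut G C K = WF_on G C K \<inter> lits_on K"

lemma WF_on_unfold: "WF_on G C K = W_op G C (WF_cut G C K)"
  unfolding WF_cut_def WF_on_def
  by (rule lfp_unfold) (intro monoI monoD[OF mono_W_op], blast)

text \<open>Dual to \<open>unf_from_accumulate\<close>: whatever \<open>K\<close> lets through of
  the limit for \<open>K'\<close> is also let through by \<open>K'\<close>, so this limit is a
  pre-fixed point of the step cut to \<open>K\<close>.\<close>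

lemma WF_on_accumulate:
  assumes "WF_on G C K' \<inter> lits_on K \<subseteq> lits_on K'"
  shows "WF_on G C K \<subseteq> WF_on G C K'"
proof -
  have "W_op G C (WF_on G C K' \<inter> lits_on K) \<subseteq> W_op G C (WF_cut G C K')"
    using assms by (intro monoD[OF mono_W_op]) (auto simp: WF_cut_def)
  then have "W_op G C (WF_on G C K' \<inter> lits_on K) \<subseteq> WF_on G C K'"
    using WF_on_unfold[of G C K'] by simp
  then show ?thesis
    unfolding WF_on_def[of G C K] by (rule lfp_lowerbound)
qed

lemma lits_on_UNIV: "lits_on UNIV = UNIV"
proof (rule UNIV_eq_I[symmetric])
  show "x \<in> lits_on UNIV" for x :: "('s, 'i) literal" by (cases x) auto
qed

lemma WF_cut_UNIV: "WF_cut G C UNIV = WF G C"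
  by (simp add: WF_cut_def WF_on_def WF_def lits_on_UNIV)

text \<open>A negative literal stems from the greatest unfounded set for this same cut model. As
  \<open>lits_on\<close> keeps every negative literal, the model already contains the negations of
  that set.\<close>

lemma WF_cut_Neg:
  assumes "Neg s a \<in> WF_cut G C K" "fmlookup C s = Some \<phi>"
  shows "a \<notin> upper G (WF_cut G C K) \<phi>"
proof -
  let ?M = "WF_cut G C K" and ?U = "U_op G C (WF_cut G C K)"
  have eq: "WF_on G C K = T_op G C ?M \<union> neg_atoms ?U"
    using WF_on_unfold[of G C K] by (simp add: W_op_def)
  then have "(s, a) \<in> ?U"
    using assms(1) by (auto simp: WF_cut_def T_op_def)
  then have "a \<notin> upper G (?M \<union> neg_atoms ?U) \<phi>"
    using unfounded_U_op[of G C ?M] assms(2) unfolding unfounded_def by blast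
  moreover have "neg_atoms ?U \<subseteq> ?M"
    using eq by (auto simp: WF_cut_def neg_atoms_def)
  ultimately show ?thesis
    by (simp add: sup.absorb1)
qed

text \<open>\<open>PB\<close> restricts \<open>K\<close> only at shape names whose variable is open,
  and there the variable must cover all domain atoms that \<open>K\<close> permits. The bound
  \<open>NB\<close> on barred variables depends on \<open>K\<close>, but \<open>K\<close> shrinks
  only at a \<open>Mu\<close>, where no barred variable is open, so \<open>NB\<close> is never
  invalidated.\<close>

lemma tr_complete:
  fixes G :: "('i, 'c, 'q) graph" and C :: "('i, 'c, 'q, 's) constraints"
  defines "PB \<equiv> \<lambda>S V K. (\<forall>t. VPos t \<in> S \<longrightarrow> {a \<in> dom_g G. (t, a) \<in> K} \<subseteq> V (VPos t)) \<and>
      (\<forall>t. VPos t \<notin> S \<longrightarrow> (\<forall>a. (t, a) \<in> K))"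
    and "NB \<equiv> \<lambda>S V C K. \<forall>t. VNeg t \<in> S \<longrightarrow> {a \<in> dom_g G. Neg t a \<in> WF_cut G C K} \<subseteq> V (VNeg t)"
  shows "S \<inter> range VNeg = {} \<Longrightarrow> PB S V K \<Longrightarrow>
      {a \<in> dom_g G. Pos s a \<in> WF_cut G C K} \<subseteq> sem G V (trp C S s)"
    and "S \<inter> range VNeg = {} \<Longrightarrow> PB S V K \<Longrightarrow>
      dom_g G \<inter> lower G (WF_cut G C K) \<phi> \<subseteq> sem G V (trp_body C S \<phi>)"
    and "PB S V K \<Longrightarrow> NB S V C K \<Longrightarrow>
      {a \<in> dom_g G. Neg s a \<in> WF_cut G C K} \<subseteq> sem G V (trn C S s)"
    and "PB S V K \<Longrightarrow> NB S V C K \<Longrightarrow>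
      dom_g G - upper G (WF_cut G C K) \<phi> \<subseteq> sem G V (trn_body C S \<phi>)"
proof (induction C S s and C S \<phi> and C S s and C S \<phi> arbitrary: V K and V K and V K and V K
    rule: trp_trp_body_trn_trn_body.induct)
  case (1 C S s)
  show ?case
  proof (cases "VPos s \<in> S")
    case True
    with 1 show ?thesis by (auto simp: trp.simps PB_def WF_cut_def)
  next
    case nin: False
    show ?thesis
    proof (cases "fmlookup C s")
      case None
      then have "Pos s a \<notin> W_op G C (WF_cut G C K)" for a
        by (auto simp: W_op_def T_op_def)
      then have "Pos s a \<notin> WF_cut G C K" for a
        unfolding WF_on_unfold[symmetric] by (simp add: WF_cut_def)
      then show ?thesis by blast
    next
      case (Some \<phi>)
      have "{a \<in> dom_g G. Pos s a \<in> WF_cut G C K} \<subseteq> E"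
        if E: "E \<subseteq> dom_g G" "sem G (V(VPos s := E)) (trp_body C (S \<union> {VPos s}) \<phi>) \<subseteq> E" for E
      proof -
        \<comment> \<open>\<open>E\<close> is an arbitrary pre-fixed point of the \<open>Mu\<close>
          body. Removing the atoms at domain nodes that \<open>E\<close> misses makes
          \<open>E\<close> a legitimate value of the opened variable.\<close>
        let ?K = "K - {s} \<times> (dom_g G - E)"
        have "PB (S \<union> {VPos s}) (V(VPos s := E)) ?K"
          using "1.prems"(2) nin unfolding PB_def by auto
        moreover have "(S \<union> {VPos s}) \<inter> range VNeg = {}"
          using "1.prems"(1) by auto
        ultimately have "dom_g G \<inter> lower G (WF_cut G C ?K) \<phi> \<subseteq> E"
          using "1.IH"[OF nin Some] E(2) by (meson subset_trans)
        then have sub: "a \<in> E" if "a \<in> dom_g G" "Pos s a \<in> WF_on G C ?K" for a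
          using that Some WF_on_unfold[of G C ?K] by (auto simp: W_op_def T_op_def)
        \<comment> \<open>At domain nodes \<open>?K\<close> derives \<open>s\<close> only inside
          \<open>E\<close>, so none of the removed atoms is ever derived and the iterations can be
          compared.\<close>
        have "x \<in> lits_on ?K" if "x \<in> WF_on G C ?K" "x \<in> lits_on K" for x
          using that sub by (cases x) auto
        then have "WF_on G C K \<subseteq> WF_on G C ?K"
          by (intro WF_on_accumulate subsetI) (metis IntE)
        with sub show ?thesis by (auto simp: WF_cut_def)
      qed
      with nin Some show ?thesis by (auto simp: trp.simps)
    qed
  qed
next
  case (4 C S s)
  have "NB S V C K"
    using 4 by (auto simp: NB_def)
  from "4.IH"[OF "4.prems"(2) this] show ?case by auto
next
  case (9 C S s)
  show ?case
  proof (cases "VNeg s \<in> S")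
    case True
    with 9 show ?thesis by (auto simp: trn.simps NB_def)
  next
    case nin: False
    show ?thesis
    proof (cases "fmlookup C s")
      case None
      with nin show ?thesis by (auto simp: trn.simps sem_Top)
    next
      case (Some \<phi>)
      \<comment> \<open>By \<open>WF_cut_Neg\<close> and the induction hypothesis this set is itself
        a post-fixed point of the \<open>Nu\<close> body.\<close>
      let ?E = "{a \<in> dom_g G. Neg s a \<in> WF_cut G C K}"
      have "PB (S \<union> {VNeg s}) (V(VNeg s := ?E)) K" "NB (S \<union> {VNeg s}) (V(VNeg s := ?E)) C K"
        using "9.prems" by (auto simp: PB_def NB_def)
      from "9.IH"[OF nin Some this]
      have "?E \<subseteq> sem G (V(VNeg s := ?E)) (trn_body C (S \<union> {VNeg s}) \<phi>)"
        using WF_cut_Neg[OF _ Some] by blast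
      then have "?E \<subseteq> sem G V (Nu (VNeg s) (trn_body C (S \<union> {VNeg s}) \<phi>))"
        unfolding sem.simps by (intro Union_upper) blast
      with nin Some show ?thesis
        by (simp add: trn.simps[of C S s] del: sem.simps)
    qed
  qed
next
  case (12 C S s)
  have "PB (pos S) V K" "pos S \<inter> range VNeg = {}"
    using "12.prems" by (auto simp: PB_def pos_def)
  with "12.IH" show ?case by auto
next
  case (2 C S A) show ?case by simp
next
  case (3 C S a) show ?case by auto
next
  case (5 C S r s)
  from "5.IH"[OF "5.prems"] show ?case using role_g_subset[of _ _ G r] by auto
next
  case (6 C S r s)
  from "6.IH"[OF "6.prems"] show ?case using role_g_subset[of _ _ G r] by auto
next
  case (7 C S s t)
  from "7.IH"(1)[OF "7.prems"] "7.IH"(2)[OF "7.prems"] show ?case by auto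
next
  case (8 C S s t)
  from "8.IH"(1)[OF "8.prems"] "8.IH"(2)[OF "8.prems"] show ?case by auto
next
  case (10 C S A) show ?case by auto
next
  case (11 C S a) show ?case by auto
next
  case (13 C S r s)
  from "13.IH"[OF "13.prems"] show ?case
    using role_g_subset[of _ _ G r] by (auto simp: upper_shape_def)
next
  case (14 C S r s)
  from "14.IH"[OF "14.prems"] show ?case
    using role_g_subset[of _ _ G r] by (auto simp: upper_shape_def)
next
  case (15 C S s t)
  from "15.IH"(1)[OF "15.prems"] "15.IH"(2)[OF "15.prems"] show ?case
    by (auto simp: upper_shape_def)
next
  case (16 C S s t)
  from "16.IH"(1)[OF "16.prems"] "16.IH"(2)[OF "16.prems"] show ?case
    by (auto simp: upper_shape_def)
qed

text \<open>With no variable open, \<open>PB\<close> forces \<open>K = UNIV\<close>, for which the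
  cut model is the full one. The restriction to the domain matters: a constraint
  \<open>BInd a\<close> makes its shape true at \<open>a\<close> even outside the graph, where no
  formula holds.\<close>

lemma WF_iff_sem_trp:
  assumes "a \<in> dom_g G" "\<And>X. V X \<subseteq> dom_g G"
  shows "Pos s a \<in> WF G C \<longleftrightarrow> a \<in> sem G V (trp C {} s)"
proof
  assume "Pos s a \<in> WF G C"
  then show "a \<in> sem G V (trp C {} s)"
    using tr_complete(1)[where S = "{}" and K = UNIV and G = G and V = V and s = s and C = C]
      assms(1) by (auto simp: WF_cut_UNIV)
next
  assume "a \<in> sem G V (trp C {} s)"
  then show "Pos s a \<in> WF G C"
    using tr_sound(1)[where S = "{}" and G = G and V = V and s = s and C = C] assms(2) by auto
qed

section \<open>Invariance under graph changes\<close>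

lemma sem_MuD:
  "a \<in> sem G V (Mu X \<phi>) \<Longrightarrow> E \<subseteq> dom_g G \<Longrightarrow> sem G (V(X := E)) \<phi> \<subseteq> E \<Longrightarrow> a \<in> E"
  unfolding sem.simps by blast

lemma sem_MuI:
  "(\<And>E. E \<subseteq> dom_g G \<Longrightarrow> sem G (V(X := E)) \<phi> \<subseteq> E \<Longrightarrow> a \<in> E) \<Longrightarrow> a \<in> sem G V (Mu X \<phi>)"
  unfolding sem.simps by blast

lemma sem_NuI:
  "a \<in> E \<Longrightarrow> E \<subseteq> dom_g G \<Longrightarrow> E \<subseteq> sem G (V(X := E)) \<phi> \<Longrightarrow> a \<in> sem G V (Nu X \<phi>)"
  unfolding sem.simps by blast

lemma sem_NuE:
  assumes "a \<in> sem G V (Nu X \<phi>)"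
  obtains E where "a \<in> E" "E \<subseteq> dom_g G" "E \<subseteq> sem G (V(X := E)) \<phi>"
  using assms unfolding sem.simps by blast

text \<open>No edge of a role in \<open>Q\<close> leaves \<open>G\<close>, so modalities never look
  outside it. The lemma serves both for cutting out a component and for adding
  \<open>p\<close>-edges.\<close>

lemma sem_component:
  assumes "dom_g G \<subseteq> dom_g G'"
    and "\<And>A. con_g G A = con_g G' A \<inter> dom_g G"
    and "set3_fm \<phi> \<subseteq> Q"
    and "\<And>r a b. set_role r \<subseteq> Q \<Longrightarrow> a \<in> dom_g G \<Longrightarrow>
      (a, b) \<in> role_g G r \<longleftrightarrow> (a, b) \<in> role_g G' r"
    and "\<And>X. V' X \<subseteq> dom_g G'" "\<And>X. V X = V' X \<inter> dom_g G"
  shows "sem G V \<phi> = sem G' V' \<phi> \<inter> dom_g G"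
  using assms
proof (induction \<phi> arbitrary: V V')
  case (And \<phi> \<psi>)
  have "sem G V \<phi> = sem G' V' \<phi> \<inter> dom_g G" "sem G V \<psi> = sem G' V' \<psi> \<inter> dom_g G"
    by (rule And.IH; use And.prems in simp)+
  then show ?case by auto
next
  case (Or \<phi> \<psi>)
  have "sem G V \<phi> = sem G' V' \<phi> \<inter> dom_g G" "sem G V \<psi> = sem G' V' \<psi> \<inter> dom_g G"
    by (rule Or.IH; use Or.prems in simp)+
  then show ?case by auto
next
  case (Box r \<phi>)
  have "sem G V \<phi> = sem G' V' \<phi> \<inter> dom_g G"
    by (rule Box.IH; use Box.prems in simp)
  moreover have "(a, b) \<in> role_g G r \<longleftrightarrow> (a, b) \<in> role_g G' r" if "a \<in> dom_g G" for a b
    using Box.prems(3) by (intro Box.prems(4) that) simp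
  moreover have "b \<in> dom_g G" if "(a, b) \<in> role_g G r" for a b
    using role_g_subset[OF that] by simp
  ultimately show ?case
    using Box.prems(1) unfolding sem.simps by blast
next
  case (Dia r \<phi>)
  have "sem G V \<phi> = sem G' V' \<phi> \<inter> dom_g G"
    by (rule Dia.IH; use Dia.prems in simp)
  moreover have "(a, b) \<in> role_g G r \<longleftrightarrow> (a, b) \<in> role_g G' r" if "a \<in> dom_g G" for a b
    using Dia.prems(3) by (intro Dia.prems(4) that) simp
  moreover have "b \<in> dom_g G" if "(a, b) \<in> role_g G r" for a b
    using role_g_subset[OF that] by simp
  ultimately show ?case
    using Dia.prems(1) unfolding sem.simps by blast
next
  case (Mu X \<phi>)
  have IH: "sem G (V(X := E' \<inter> dom_g G)) \<phi> = sem G' (V'(X := E')) \<phi> \<inter> dom_g G"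
    if "E' \<subseteq> dom_g G'" for E'
    by (rule Mu.IH) (use Mu.prems that in auto)
  have 1: "sem G V (Mu X \<phi>) \<subseteq> sem G' V' (Mu X \<phi>)"
  proof (intro subsetI sem_MuI)
    fix a E'
    assume a: "a \<in> sem G V (Mu X \<phi>)"
      and E': "E' \<subseteq> dom_g G'" "sem G' (V'(X := E')) \<phi> \<subseteq> E'"
    have "sem G (V(X := E' \<inter> dom_g G)) \<phi> \<subseteq> E' \<inter> dom_g G"
      using IH[OF E'(1)] E'(2) by blast
    then have "a \<in> E' \<inter> dom_g G"
      by (intro sem_MuD[OF a]) blast
    then show "a \<in> E'" by blast
  qed
  have 2: "sem G' V' (Mu X \<phi>) \<inter> dom_g G \<subseteq> sem G V (Mu X \<phi>)"
  proof (intro subsetI sem_MuI)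
    fix a E
    assume a: "a \<in> sem G' V' (Mu X \<phi>) \<inter> dom_g G"
      and E: "E \<subseteq> dom_g G" "sem G (V(X := E)) \<phi> \<subseteq> E"
    \<comment> \<open>With all nodes outside \<open>G\<close> added, the set is trivially pre-fixed
      there. For \<open>Nu\<close> below, the opposite choice works: no outside node is
      added.\<close>
    let ?E = "E \<union> (dom_g G' - dom_g G)"
    have E': "?E \<subseteq> dom_g G'" "?E \<inter> dom_g G = E"
      using E(1) Mu.prems(1) by auto
    have "sem G' (V'(X := ?E)) \<phi> \<subseteq> dom_g G'"
      by (rule sem_subset) (use Mu.prems(5) E'(1) in auto)
    moreover have "sem G' (V'(X := ?E)) \<phi> \<inter> dom_g G \<subseteq> E"
      using IH[OF E'(1)] E(2) unfolding E'(2) by blast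
    ultimately have "sem G' (V'(X := ?E)) \<phi> \<subseteq> ?E" by blast
    then have "a \<in> ?E"
      by (rule sem_MuD[OF IntD1[OF a] E'(1)])
    then show "a \<in> E" using a by blast
  qed
  have "sem G V (Mu X \<phi>) \<subseteq> dom_g G"
    by (rule sem_subset) (use Mu.prems(6) in blast)
  with 1 2 show ?case by blast
next
  case (Nu X \<phi>)
  have IH: "sem G (V(X := E' \<inter> dom_g G)) \<phi> = sem G' (V'(X := E')) \<phi> \<inter> dom_g G"
    if "E' \<subseteq> dom_g G'" for E'
    by (rule Nu.IH) (use Nu.prems that in auto)
  have 1: "sem G' V' (Nu X \<phi>) \<inter> dom_g G \<subseteq> sem G V (Nu X \<phi>)"
  proof
    fix a
    assume a: "a \<in> sem G' V' (Nu X \<phi>) \<inter> dom_g G"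
    from IntD1[OF a] obtain E' where
      E': "a \<in> E'" "E' \<subseteq> dom_g G'" "E' \<subseteq> sem G' (V'(X := E')) \<phi>"
      by (rule sem_NuE)
    have "E' \<inter> dom_g G \<subseteq> sem G (V(X := E' \<inter> dom_g G)) \<phi>"
      using IH[OF E'(2)] E'(3) by blast
    then show "a \<in> sem G V (Nu X \<phi>)"
      by (rule sem_NuI[rotated 2]) (use a E'(1) in blast)+
  qed
  have 2: "sem G V (Nu X \<phi>) \<subseteq> sem G' V' (Nu X \<phi>)"
  proof
    fix a
    assume "a \<in> sem G V (Nu X \<phi>)"
    then obtain E where E: "a \<in> E" "E \<subseteq> dom_g G" "E \<subseteq> sem G (V(X := E)) \<phi>"
      by (rule sem_NuE)
    have E': "E \<subseteq> dom_g G'" "E \<inter> dom_g G = E"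
      using E(2) Nu.prems(1) by auto
    have "E \<subseteq> sem G' (V'(X := E)) \<phi>"
      using IH[OF E'(1)] E(3) unfolding E'(2) by blast
    then show "a \<in> sem G' V' (Nu X \<phi>)"
      by (rule sem_NuI[OF E(1) E'(1)])
  qed
  have "sem G V (Nu X \<phi>) \<subseteq> dom_g G"
    by (rule sem_subset) (use Nu.prems(6) in blast)
  with 1 2 show ?case by blast
qed auto

section \<open>Role names and free variables of translated formulas\<close>

lemma set3_fm_Top [simp]: "set3_fm Top = {}"
  by (simp add: Top_def)

text \<open>\<open>set3_fm\<close> yields the role names of a formula. The bound lets
  \<open>Q\<close> in \<open>sem_component\<close> be the roles of the document, which makes edges
  of a fresh role invisible.\<close>

lemma set3_fm_trp:
  fixes C :: "('i, 'c, 'q, 's) constraints"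
  defines "Q \<equiv> \<lambda>C. \<Union>\<phi>\<in>fmran' C. body_roles \<phi>"
  shows "set3_fm (trp C S s) \<subseteq> Q C"
    and "set3_fm (trp_body C S \<phi>) \<subseteq> body_roles \<phi> \<union> Q C"
    and "set3_fm (trn C S s) \<subseteq> Q C"
    and "set3_fm (trn_body C S \<phi>) \<subseteq> body_roles \<phi> \<union> Q C"
proof (induction C S s and C S \<phi> and C S s and C S \<phi> rule: trp_trp_body_trn_trn_body.induct)
  case (1 C S s)
  show ?case
  proof (cases "VPos s \<notin> S \<and> fmlookup C s \<noteq> None")
    case True
    then obtain \<phi> where \<phi>: "VPos s \<notin> S" "fmlookup C s = Some \<phi>" by auto
    then have "body_roles \<phi> \<subseteq> Q C" by (auto simp: Q_def intro: fmran'I)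
    with "1.IH"[OF \<phi>] \<phi> show ?thesis by (auto simp: trp.simps)
  qed (auto simp: trp.simps Bot_def)
next
  case (9 C S s)
  show ?case
  proof (cases "VNeg s \<notin> S \<and> fmlookup C s \<noteq> None")
    case True
    then obtain \<phi> where \<phi>: "VNeg s \<notin> S" "fmlookup C s = Some \<phi>" by auto
    then have "body_roles \<phi> \<subseteq> Q C" by (auto simp: Q_def intro: fmran'I)
    with "9.IH"[OF \<phi>] \<phi> show ?thesis by (auto simp: trn.simps)
  qed (auto simp: trn.simps)
qed auto

lemma free_vars_tr:
  fixes C :: "('i, 'c, 'q, 's) constraints"
  shows "free_vars (trp C S s) \<subseteq> S"
    and "free_vars (trp_body C S \<phi>) \<subseteq> S"
    and "free_vars (trn C S s) \<subseteq> S"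
    and "free_vars (trn_body C S \<phi>) \<subseteq> S"
proof (induction C S s and C S \<phi> and C S s and C S \<phi> rule: trp_trp_body_trn_trn_body.induct)
  case (1 C S s)
  show ?case
  proof (cases "VPos s \<notin> S \<and> fmlookup C s \<noteq> None")
    case True
    then obtain \<phi> where \<phi>: "VPos s \<notin> S" "fmlookup C s = Some \<phi>" by auto
    with "1.IH"[OF \<phi>] show ?thesis by (auto simp: trp.simps)
  qed (auto simp: trp.simps Bot_def)
next
  case (9 C S s)
  show ?case
  proof (cases "VNeg s \<notin> S \<and> fmlookup C s \<noteq> None")
    case True
    then obtain \<phi> where \<phi>: "VNeg s \<notin> S" "fmlookup C s = Some \<phi>" by auto
    with "9.IH"[OF \<phi>] show ?thesis by (auto simp: trn.simps)
  qed (auto simp: trn.simps Top_def)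
qed (auto simp: pos_def)

lemma free_vars_Conj:
  assumes "finite M"
  shows "free_vars (Conj M f) \<subseteq> (\<Union>x\<in>M. free_vars (f x))"
proof -
  have "free_vars (foldr (\<lambda>x. And (f x)) xs Top) \<subseteq> (\<Union>x\<in>set xs. free_vars (f x))" for xs
    by (induction xs) (auto simp: Top_def)
  moreover have "set (SOME xs. set xs = M \<and> distinct xs) = M"
    using someI_ex[OF finite_distinct_list[OF assms]] by simp
  ultimately show ?thesis
    unfolding Conj_def by metis
qed

section \<open>Nodes and their connected components\<close>

fun matches :: "('i, 'c, 'q) graph \<Rightarrow> ('i, 'c, 'q) target_exp \<Rightarrow> 'i \<Rightarrow> bool" where
  "matches G (TInd b) a \<longleftrightarrow> a = b"
| "matches G (TCon A) a \<longleftrightarrow> a \<in> con_g G A"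
| "matches G (TRole r) a \<longleftrightarrow> (\<exists>b. (a, b) \<in> role_g G r)"

text \<open>Shape membership is read through the translation instead of the well-founded model, so
  that locality of formulas applies to it directly.\<close>

fun node_ok :: "('i, 'c, 'q) graph \<Rightarrow> ('i, 'c, 'q, 's) document \<Rightarrow> 'i \<Rightarrow> bool" where
  "node_ok G (C, T) a \<longleftrightarrow> (\<forall>(l, s)\<in>T. matches G l a \<longrightarrow> a \<in> sem G (\<lambda>_. {}) (trp C {} s))"

lemma sem_Theta:
  assumes "shacl_document D"
  shows "sem G V (Theta D) = {a \<in> dom_g G. node_ok G D a}"
proof -
  obtain C T where D: "D = (C, T)" by (cases D)
  have eq: "sem G V (trp C {} s) = sem G (\<lambda>_. {}) (trp C {} s)" for s
    by (rule sem_cong) (use free_vars_tr(1)[of C "{}" s] in auto)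
  have "sem G V (neg (Dia r Top)) = dom_g G - {a. matches G (TRole r) a}" for r
    using role_g_subset[of _ _ G r] con_g_subset[of G] by (auto simp: Top_def)
  then have m: "sem G V (case l of TInd a \<Rightarrow> NNom a | TCon A \<Rightarrow> NCon A | TRole r \<Rightarrow> neg (Dia r Top))
      = dom_g G - {a. matches G l a}" for l
    by (cases l) auto
  have "finite T" using assms D by simp
  then show ?thesis
    unfolding D Theta.simps by (auto simp: sem_Conj m eq split: prod.splits)
qed

text \<open>Compatibility puts individual targets into the domain, where concept and role targets
  lie in any case. So a check of all domain nodes misses no target.\<close>

lemma satisfies_iff_node_ok:
  assumes "compatible G D"
  shows "satisfies G D \<longleftrightarrow> (\<forall>a\<in>dom_g G. node_ok G D a)"
proof -
  obtain C T where D: "D = (C, T)" by (cases D)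
  have "matches G l a \<Longrightarrow> (l, s) \<in> T \<Longrightarrow> a \<in> dom_g G" for l a s
    using assms con_g_subset[of G] role_g_subset[of _ _ G]
    by (cases l) (force simp: compatible_def D)+
  moreover have "satisfies G D \<longleftrightarrow> (\<forall>(l, s)\<in>T. \<forall>a. matches G l a \<longrightarrow> Pos s a \<in> WF G C)"
    unfolding D satisfies.simps
  proof (intro iffI, goal_cases)
    case 1
    then have "Pos s a \<in> WF G C" if "(l, s) \<in> T" "matches G l a" for l s a
      using that by (cases l) fastforce+
    then show ?case by blast
  next
    case 2
    then have "Pos s a \<in> WF G C" if "(l, s) \<in> T" "matches G l a" for l s a
      using that by blast
    then show ?case by (metis (no_types, lifting) case_prodI2 matches.simps)
  qed
  moreover have "Pos s a \<in> WF G C \<longleftrightarrow> a \<in> sem G (\<lambda>_. {}) (trp C {} s)" if "a \<in> dom_g G" for s a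
    using that by (rule WF_iff_sem_trp) simp
  ultimately show ?thesis
    unfolding D by fastforce
qed

lemma node_ok_component:
  assumes sub: "dom_g G \<subseteq> dom_g G'"
    and con: "\<And>A. con_g G A = con_g G' A \<inter> dom_g G"
    and rol: "\<And>r a b. set_role r \<subseteq> doc_roles D \<Longrightarrow> a \<in> dom_g G \<Longrightarrow>
      (a, b) \<in> role_g G r \<longleftrightarrow> (a, b) \<in> role_g G' r"
    and a: "a \<in> dom_g G"
  shows "node_ok G D a \<longleftrightarrow> node_ok G' D a"
proof -
  obtain C T where D: "D = (C, T)" by (cases D)
  have "sem G (\<lambda>_. {}) (trp C {} s) = sem G' (\<lambda>_. {}) (trp C {} s) \<inter> dom_g G" for s
    by (rule sem_component[where Q = "doc_roles D"])
      (use sub con rol set3_fm_trp(1)[of C "{}" s] in \<open>auto simp: D\<close>)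
  moreover have "matches G l a \<longleftrightarrow> matches G' l a" if "(l, s) \<in> T" for l s
  proof (cases l)
    case (TRole r)
    then have "set_role r \<subseteq> doc_roles D" using that by (force simp: D)
    then show ?thesis using rol a TRole by simp
  qed (use con a in auto)
  ultimately show ?thesis using a unfolding D by auto
qed

section \<open>Connected components and the formula \<open>Lambda\<close>\<close>

definition edges :: "('i, 'c, 'q) graph \<Rightarrow> 'q set \<Rightarrow> ('i \<times> 'i) set" where
  "edges G Q = {(a, b). \<exists>q\<in>Q. QAtom q a b \<in> G \<or> QAtom q b a \<in> G}"

lemma edges_dom: "(a, b) \<in> edges G Q \<Longrightarrow> a \<in> dom_g G \<and> b \<in> dom_g G"
  by (auto simp: edges_def dom_g_def)

lemma edges_rtrancl_sym: "(a, b) \<in> (edges G Q)\<^sup>* \<Longrightarrow> (b, a) \<in> (edges G Q)\<^sup>*"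
  by (rule symD[OF sym_rtrancl]) (auto simp: sym_def edges_def)

lemma edges_rtrancl_dom: "(a, b) \<in> (edges G Q)\<^sup>* \<Longrightarrow> a \<in> dom_g G \<Longrightarrow> b \<in> dom_g G"
  by (erule rtrancl_induct) (auto dest: edges_dom)

text \<open>The boxes for \<open>Dir r\<close> and \<open>Inv r\<close> together follow the
  symmetric relation \<open>edges\<close>. A post-fixed point is thus closed under connectedness and
  has only good nodes, and the nodes whose whole component is good form the largest such
  set.\<close>

lemma sem_Lambda:
  assumes "shacl_document D" "finite R"
  shows "sem G V (Lambda R D p) =
    {a \<in> dom_g G. \<forall>b. (a, b) \<in> (edges G (insert p R))\<^sup>* \<longrightarrow> node_ok G D b}" (is "_ = ?B")
proof -
  define F where "F E = {a \<in> dom_g G. node_ok G D a \<and>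
    (\<forall>b. (a, b) \<in> edges G (insert p R) \<longrightarrow> b \<in> E)}" for E
  define B where "B = ?B"
  have "finite (R \<union> {p})"
    using assms(2) by simp
  then have step: "sem G (V(VReach := E)) (And (Theta D)
       (And (Conj (R \<union> {p}) (\<lambda>r. Box (Inv r) (Var VReach)))
            (Conj (R \<union> {p}) (\<lambda>r. Box (Dir r) (Var VReach))))) = F E" for E
    unfolding F_def by (auto simp: sem_Theta[OF assms(1)] sem_Conj edges_def)
  have "E \<subseteq> B" if E: "E \<subseteq> dom_g G" "E \<subseteq> F E" for E
  proof
    fix a
    assume a: "a \<in> E"
    have "b \<in> E" if "(a, b) \<in> (edges G (insert p R))\<^sup>*" for b
      using that a by (induction rule: rtrancl_induct) (use E in \<open>auto simp: F_def\<close>)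
    moreover have "node_ok G D b" if "b \<in> E" for b
      using that E(2) by (auto simp: F_def)
    ultimately show "a \<in> B"
      using E(1) a by (auto simp: B_def)
  qed
  moreover have "B \<subseteq> F B"
    by (auto simp: B_def F_def dest: edges_dom intro: converse_rtrancl_into_rtrancl)
  moreover have "B \<subseteq> dom_g G"
    by (auto simp: B_def)
  ultimately have "\<Union> {E. E \<subseteq> dom_g G \<and> E \<subseteq> F E} = B"
    by (intro equalityI Union_least Union_upper) auto
  then show ?thesis
    unfolding Lambda_def sem.simps(11) step B_def .
qed

lemma free_vars_Lambda:
  assumes "shacl_document D" "finite R"
  shows "free_vars (Lambda R D p) = {}"
proof -
  obtain C T where D: "D = (C, T)" by (cases D)
  have T: "finite T" using assms D by simp
  have "free_vars (Theta D) = {}"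
    using free_vars_Conj[OF T] free_vars_tr(1)[of C "{}"] unfolding D Theta.simps
    by (fastforce simp: Top_def split: target_exp.splits)
  moreover have "free_vars (Conj (R \<union> {p}) (\<lambda>q. Box (d q) (Var VReach))) \<subseteq> {VReach}" for d
    by (rule subset_trans[OF free_vars_Conj]) (use assms(2) in auto)
  ultimately show ?thesis
    unfolding Lambda_def by auto
qed

lemma finite_doc:
  assumes "shacl_document D"
  shows "finite (doc_inds D)" "finite (doc_roles D)"
proof -
  obtain C T where D: "D = (C, T)" by (cases D)
  have fr: "finite (set_role r)" for r :: "'x role" by (cases r) auto
  have "finite (body_inds \<phi>)" "finite (body_roles \<phi>)" for \<phi> :: "('a, 'b, 'c, 'd) body"
    by (cases \<phi>; simp add: fr)+
  moreover have "finite (target_inds l)" "finite (target_roles l)" for l :: "('a, 'b, 'c) target_exp"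
    by (cases l; simp add: fr)+
  moreover have "finite (fmran' C)" by (simp add: fmran'_alt_def)
  ultimately show "finite (doc_inds D)" "finite (doc_roles D)"
    using assms unfolding D by auto
qed

section \<open>The reduction\<close>

lemma holds_reduction:
  assumes "shacl_document D" "shacl_document D'" "finite I" "finite R" "finite R'"
    and "c \<in> dom_g G"
  shows "holds G c (And (Conj I (\<lambda>a. Dia (Dir p) (And (Nom a) (Lambda R D p))))
                (Dia (Dir p) (neg (Lambda R' D' p)))) \<longleftrightarrow>
    (\<forall>a\<in>I. QAtom p c a \<in> G \<and> (\<forall>b. (a, b) \<in> (edges G (insert p R))\<^sup>* \<longrightarrow> node_ok G D b)) \<and>
    (\<exists>v. QAtom p c v \<in> G \<and> (\<exists>b. (v, b) \<in> (edges G (insert p R'))\<^sup>* \<and> \<not> node_ok G D' b))"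
proof -
  have dom: "QAtom p c v \<in> G \<Longrightarrow> v \<in> dom_g G" for v
    by (auto simp: dom_g_def)
  have neg: "v \<in> sem G (\<lambda>_. {}) (neg (Lambda R' D' p)) \<longleftrightarrow> v \<notin> sem G (\<lambda>_. {}) (Lambda R' D' p)"
    if "v \<in> dom_g G" for v
    using holds_neg[OF free_vars_Lambda[OF assms(2,5)] that] by (simp add: holds_def)
  show ?thesis
    unfolding holds_def
    using assms(6) dom neg
    by (auto simp: sem_Conj[OF assms(3)] sem_Lambda[OF assms(1,4)] sem_Lambda[OF assms(2,5)])
qed

lemma counterexample_to_model:
  fixes G :: "('i, 'c, 'q) graph" and D D' :: "('i, 'c, 'q, 's) document"
  assumes D: "shacl_document D" and D': "shacl_document D'"
    and p: "p \<notin> doc_roles D \<union> doc_roles D'"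
    and I: "I = (if doc_inds D \<union> doc_inds D' = {} then {a0} else doc_inds D \<union> doc_inds D')"
    and comp: "compatible G D" "compatible G D'"
    and sat: "satisfies G D" "\<not> satisfies G D'"
  obtains G' c where "G \<subseteq> G'" "finite (G' - G)" "c \<in> dom_g G'"
    "holds G' c (And (Conj I (\<lambda>a. Dia (Dir p) (And (Nom a) (Lambda (doc_roles D \<union> doc_roles D') D p))))
                (Dia (Dir p) (neg (Lambda (doc_roles D') D' p))))"
proof -
  obtain v where v: "v \<in> dom_g G" "\<not> node_ok G D' v"
    using sat(2) satisfies_iff_node_ok[OF comp(2)] by auto
  have finI: "finite I"
    using I finite_doc[OF D] finite_doc[OF D'] by simp
  define G' where "G' = G \<union> QAtom p v ` insert v I"
  have pG': "QAtom p v a \<in> G'" if "a = v \<or> a \<in> I" for a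
    using that by (auto simp: G'_def)
  have dom: "dom_g G' = dom_g G \<union> I"
  proof
    show "dom_g G' \<subseteq> dom_g G \<union> I"
      using v(1) by (auto simp: G'_def dom_g_def)
    show "dom_g G \<union> I \<subseteq> dom_g G'"
      using pG' unfolding dom_g_def G'_def by blast
  qed
  have con: "con_g G' A = con_g G A" for A
    by (auto simp: G'_def con_g_def)
  have rol: "role_g G' r = role_g G r" if "set_role r \<subseteq> doc_roles D \<union> doc_roles D'" for r
    using that p by (cases r) (auto simp: G'_def)
  have con_int: "con_g G A = con_g G' A \<inter> dom_g G" for A
    using con con_g_subset[of G A] by blast
  have ok: "node_ok G E b \<longleftrightarrow> node_ok G' E b"
    if "doc_roles E \<subseteq> doc_roles D \<union> doc_roles D'" "b \<in> dom_g G" for b and E :: "('i, 'c, 'q, 's) document"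
  proof (rule node_ok_component[OF _ con_int _ that(2)])
    show "dom_g G \<subseteq> dom_g G'" by (simp add: dom)
    show "(a, b) \<in> role_g G r \<longleftrightarrow> (a, b) \<in> role_g G' r" if "set_role r \<subseteq> doc_roles E" for r a b
      using rol[of r] that \<open>doc_roles E \<subseteq> _\<close> by blast
  qed
  have okD: "node_ok G' D b" if "b \<in> dom_g G'" for b
  proof (cases "b \<in> dom_g G")
    case True
    then show ?thesis using ok[of D] sat(1) satisfies_iff_node_ok[OF comp(1)] by simp
  next
    case False
    with that dom have "b \<in> I" by blast
    \<comment> \<open>A node outside \<open>G\<close> can only be the default \<open>a0\<close>,
      since individuals of the documents lie in \<open>G\<close> by compatibility. It carries only a
      \<open>p\<close>-edge and so matches no target of \<open>D\<close>.\<close>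
    with False comp I have no_inds: "doc_inds D = {}"
      by (auto simp: compatible_def split: if_splits)
    obtain C T where CT: "D = (C, T)" by (cases D)
    have "\<not> matches G' l b" if "(l, s) \<in> T" for l s
    proof (cases l)
      case (TInd a)
      then show ?thesis using that no_inds by (force simp: CT)
    next
      case (TCon A)
      then show ?thesis using con con_g_subset[of G] False by auto
    next
      case (TRole r)
      then have "set_role r \<subseteq> doc_roles D" using that by (force simp: CT)
      then show ?thesis
        using rol[of r] role_g_subset[of b _ G r] False TRole by auto
    qed
    then show ?thesis unfolding CT by auto
  qed
  have fin: "finite (doc_roles D \<union> doc_roles D')" "finite (doc_roles D')"
    using finite_doc[OF D] finite_doc[OF D'] by auto
  have vG': "v \<in> dom_g G'" using dom v by auto
  have "\<not> node_ok G' D' v" using ok[of D'] v by simp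
  moreover have "node_ok G' D b" if "(a, b) \<in> (edges G' Q)\<^sup>*" "a \<in> I" for a b Q
    using edges_rtrancl_dom[OF that(1)] that(2) dom okD by blast
  ultimately have "holds G' v
    (And (Conj I (\<lambda>a. Dia (Dir p) (And (Nom a) (Lambda (doc_roles D \<union> doc_roles D') D p))))
         (Dia (Dir p) (neg (Lambda (doc_roles D') D' p))))"
    unfolding holds_reduction[OF D D' finI fin vG'] using pG' by blast
  moreover have "finite (G' - G)"
    by (rule finite_subset[of _ "QAtom p v ` insert v I"]) (use finI in \<open>auto simp: G'_def\<close>)
  ultimately show ?thesis
    using that[of G' v] vG' by (auto simp: G'_def)
qed

lemma model_to_counterexample:
  fixes G' :: "('i, 'c, 'q) graph" and D D' :: "('i, 'c, 'q, 's) document"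
  assumes D: "shacl_document D" and D': "shacl_document D'"
    and I: "I = (if doc_inds D \<union> doc_inds D' = {} then {a0} else doc_inds D \<union> doc_inds D')"
    and c: "c \<in> dom_g G'"
    and model: "holds G' c
      (And (Conj I (\<lambda>a. Dia (Dir p) (And (Nom a) (Lambda (doc_roles D \<union> doc_roles D') D p))))
           (Dia (Dir p) (neg (Lambda (doc_roles D') D' p))))"
  obtains G where "G \<subseteq> G'" "compatible G D" "compatible G D'" "satisfies G D" "\<not> satisfies G D'"
proof -
  let ?R = "doc_roles D \<union> doc_roles D'"
  let ?Q = "insert p ?R"
  have fin: "finite I" "finite ?R" "finite (doc_roles D')"
    using I finite_doc[OF D] finite_doc[OF D'] by auto
  note model = model[unfolded holds_reduction[OF D D' fin c]]
  from model obtain v w where v: "QAtom p c v \<in> G'"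
    and w: "(v, w) \<in> (edges G' (insert p (doc_roles D')))\<^sup>*" "\<not> node_ok G' D' w"
    by blast
  define Z where "Z = {z. (c, z) \<in> (edges G' ?Q)\<^sup>*}"
  have pZ: "a \<in> Z" if "QAtom p c a \<in> G'" for a
    using that by (auto simp: Z_def edges_def)
  have closed: "b \<in> Z" if "a \<in> Z" "(a, b) \<in> edges G' ?Q" for a b
    using that by (auto simp: Z_def)
  \<comment> \<open>The path to \<open>w\<close> uses only \<open>p\<close> and roles of
    \<open>D'\<close>, so it stays within the larger relation over \<open>?Q\<close>.\<close>
  have wZ: "w \<in> Z"
  proof -
    have "(v, w) \<in> (edges G' ?Q)\<^sup>*"
      by (rule subsetD[OF rtrancl_mono, OF _ w(1)]) (auto simp: edges_def)
    with pZ[OF v] show ?thesis by (auto simp: Z_def)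
  qed
  have IZ: "I \<subseteq> Z" using model pZ by blast
  have okZ: "node_ok G' D z" if "z \<in> Z" for z
  proof -
    have "I \<noteq> {}" unfolding I by simp
    then obtain a where a: "a \<in> I" by blast
    then have "(c, a) \<in> (edges G' ?Q)\<^sup>*" using IZ by (auto simp: Z_def)
    then have "(a, z) \<in> (edges G' ?Q)\<^sup>*"
      using that rtrancl_trans[OF edges_rtrancl_sym] by (simp add: Z_def)
    with a model show ?thesis by blast
  qed
  \<comment> \<open>The \<open>p\<close>-edges are retained because a node belongs to
    \<open>dom_g\<close> only through an atom, and these may be its only ones.\<close>
  define G where "G = {CAtom A a | A a. CAtom A a \<in> G' \<and> a \<in> Z} \<union>
    {QAtom q a b | q a b. QAtom q a b \<in> G' \<and> q \<in> ?Q \<and> a \<in> Z \<and> b \<in> Z}"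
  have edgeG: "a \<in> dom_g G \<and> b \<in> dom_g G" if "a \<in> Z" "(a, b) \<in> edges G' ?Q" for a b
    using that closed[OF that] by (auto simp: edges_def G_def dom_g_def)
  \<comment> \<open>The last edge of a path from \<open>c\<close> puts \<open>z\<close> into the
    domain; for the empty path the edge from \<open>c\<close> to \<open>v\<close> does.\<close>
  have "z \<in> dom_g G" if "z \<in> Z" for z
  proof -
    have "(c, z) \<in> (edges G' ?Q)\<^sup>*" using that by (simp add: Z_def)
    then show ?thesis
    proof (cases rule: rtranclE)
      case base
      then show ?thesis using edgeG[of c v] v by (auto simp: Z_def edges_def)
    next
      case (step y)
      then show ?thesis using edgeG[of y z] by (auto simp: Z_def)
    qed
  qed
  moreover have "dom_g G \<subseteq> Z" by (auto simp: G_def dom_g_def)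
  ultimately have dom: "dom_g G = Z" by blast
  have sub: "G \<subseteq> G'" by (auto simp: G_def)
  have Zdom: "Z \<subseteq> dom_g G'"
    using edges_rtrancl_dom[OF _ c] by (auto simp: Z_def)
  have con: "con_g G A = con_g G' A \<inter> Z" for A
    by (auto simp: G_def con_g_def)
  have rol: "(a, b) \<in> role_g G r \<longleftrightarrow> (a, b) \<in> role_g G' r"
    if "set_role r \<subseteq> ?R" "a \<in> Z" for r a b
  proof (cases r)
    case (Dir q)
    then show ?thesis using that closed[of a b] by (auto simp: G_def edges_def)
  next
    case (Inv q)
    then show ?thesis using that closed[of a b] by (auto simp: G_def edges_def)
  qed
  have ok: "node_ok G E b \<longleftrightarrow> node_ok G' E b"
    if "doc_roles E \<subseteq> ?R" "b \<in> Z" for b and E :: "('i, 'c, 'q, 's) document"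
  proof (rule node_ok_component)
    show "(a, b) \<in> role_g G r \<longleftrightarrow> (a, b) \<in> role_g G' r"
      if "set_role r \<subseteq> doc_roles E" "a \<in> dom_g G" for r a b
      by (rule rol) (use that \<open>doc_roles E \<subseteq> ?R\<close> dom in auto)
  qed (simp_all add: dom Zdom con \<open>b \<in> Z\<close>)
  have comp: "compatible G D" "compatible G D'"
    using IZ I dom by (auto simp: compatible_def split: if_splits)
  have "satisfies G D"
    using satisfies_iff_node_ok[OF comp(1)] ok[of D] okZ dom by simp
  moreover have "\<not> satisfies G D'"
    using satisfies_iff_node_ok[OF comp(2)] ok[of D'] w(2) wZ dom by auto
  ultimately show ?thesis
    using that sub comp by blast
qed

theorem theorem4:
  fixes D D' :: "('i::infinite, 'c, 'q, 's) document"
    and I :: "'i set" and R R' :: "'q set" and p :: 'q and a0 :: 'i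
    and \<Phi> :: "('i, 'c, 'q, 's fvar) fm"
  assumes "shacl_document D" and "shacl_document D'"
    and "p \<notin> doc_roles D \<union> doc_roles D'"
    and "I = (if doc_inds D \<union> doc_inds D' = {} then {a0} else doc_inds D \<union> doc_inds D')"
    and "R = doc_roles D \<union> doc_roles D'"
    and "R' = doc_roles D'"
    and "\<Phi> = And (Conj I (\<lambda>a. Dia (Dir p) (And (Nom a) (Lambda R D p))))
                (Dia (Dir p) (neg (Lambda R' D' p)))"
  shows "(implies D D' \<longleftrightarrow> \<not> satisfiable \<Phi>) \<and>
         (fin_implies D D' \<longleftrightarrow> \<not> fin_satisfiable \<Phi>)"
proof -
  have to_model: "\<exists>G' c. G \<subseteq> G' \<and> finite (G' - G) \<and> c \<in> dom_g G' \<and> holds G' c \<Phi>"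
    if "compatible G D" "compatible G D'" "satisfies G D" "\<not> satisfies G D'" for G
    using counterexample_to_model[OF assms(1-4) that] unfolding assms(5-7) by metis
  have to_counterexample: "\<exists>G. G \<subseteq> G' \<and> compatible G D \<and> compatible G D' \<and>
      satisfies G D \<and> \<not> satisfies G D'"
    if "c \<in> dom_g G'" "holds G' c \<Phi>" for G' c
    using model_to_counterexample[OF assms(1,2,4) that(1) that(2)[unfolded assms(5-7)]] by metis
  \<comment> \<open>Only finitely many atoms are added, so countability and finiteness both carry
    over; in the other direction they pass to the subgraph.\<close>
  have cnt: "countable G'" if "countable G" "finite (G' - G)" for G G' :: "('i, 'c, 'q) graph"
    using that by (metis countable_Un_iff countable_finite Un_Diff_cancel)
  have fin: "finite G'" if "finite G" "finite (G' - G)" for G G' :: "('i, 'c, 'q) graph"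
    using that by simp
  have "implies D D' \<longleftrightarrow> \<not> satisfiable \<Phi>"
    unfolding implies_def satisfiable_def
    using to_model to_counterexample cnt countable_subset by metis
  moreover have "fin_implies D D' \<longleftrightarrow> \<not> fin_satisfiable \<Phi>"
    unfolding fin_implies_def fin_satisfiable_def
    using to_model to_counterexample fin finite_subset by metis
  ultimately show ?thesis by blast
qed

end
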